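(* Fix $1\leqslant p\leqslant\infty$. Suppose that $U$ is a Banach space with $1$-unconditional basis $E$ and $\alpha$ is an ordinal such that for each $e\in E$, $X_e$ is a Banach space with $I_p(X_e)<\omega^{\omega^\alpha}$ (or $I_p(X_e)\leqslant\omega^{\omega^\alpha}$ in the case that $p=1$). Then for any $1\leqslant K<C$, $I_p(X_E,K)\leqslant\omega^{\omega^\alpha}\,I_p(U,C)$.
   Context: The $1$-unconditional basis $E$ need not be ordered or countable. $X_E=\bigl(\oplus X_e\bigr)_{e\in E}=\{(x_e)_{e\in E}:x_e\in X_e,\ \sum_{e\in E}\|x_e\|e\in U\}$, a Banach space with norm $\|(x_e)\|=\|\sum_{e\in E}\|x_e\|e\|_U$. Trees: a tree is a set of finite sequences (including $\varnothing$) closed under initial segments. $T'$ is $T$ with its maximal members removed, $d^0(T)=T$, $d^{\xi+1}(T)=(d^\xi(T))'$, $d^\xi(T)=\bigcap_{\zeta<\xi}d^\zeta(T)$ for limit $\xi$, $o(T)=\min\{\xi:d^\xi(T)=\varnothing\}$, with $o(T)=\infty$ if no such ordinal exists. Conventions: $\xi<\infty$ for all ordinals $\xi$, and products involving $\infty$ equal $\infty$. Products of ordinals are the usual ordinal products. $T_p(X,K)$ is the tree of all finite sequences $(x_i)_{i=1}^n$ in the unit ball $B_X$ with $K^{-1}\leqslant\|\sum_{i=1}^na_ix_i\|\leqslant1$ for all $(a_i)_{i=1}^n$ in the unit sphere of $\ell_p^n$. $I_p(X,K)=o(T_p(X,K))$ and $I_p(X)=\sup_{K\geqslant1}I_p(X,K)$.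 *)

theory Defs
  imports "HOL-Analysis.Analysis" "HOL-Library.Function_Algebras" "HOL-Library.Sublist"
begin

unbundle cardinal_syntax

section \<open>Ordinals\<close>

text \<open>
  The elements of \<open>'a ordinal\<close> are the ordinals of cardinality at most that of the infinite type
  \<open>'a list\<close>, i.e. the members of the initial ordinal that is the cardinal successor of
  \<open>|'a list|\<close>. The lemmas \<open>bdd_above_small\<close> and \<open>ordinal_of_well_order\<close> below state that all
  suprema of at most \<open>|'a list|\<close> many ordinals exist and that every well-order on a subset of
  \<open>'a list\<close> has its order type in \<open>'a ordinal\<close>. Since \<open>'a\<close> is arbitrary, a
  statement about all \<open>\<alpha> :: 'a ordinal\<close> with \<open>'a\<close> a free type variable is one about all ordinals.
\<close>

abbreviation ord_rel :: "'a list set rel" where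
  "ord_rel \<equiv> cardSuc (card_of (UNIV :: 'a list set))"

lemma ord_rel_Card_order: "Card_order (ord_rel :: 'a list set rel)"
  by (simp add: cardSuc_Card_order card_of_Card_order)

lemma ord_rel_Well_order: "Well_order (ord_rel :: 'a list set rel)"
  using ord_rel_Card_order card_order_on_well_order_on by blast

lemma ord_rel_infinite: "infinite (Field (ord_rel :: 'a list set rel))"
  by (simp add: card_of_cardSuc_finite infinite_UNIV_listI)

typedef 'a ordinal = "Field (ord_rel :: 'a list set rel)"
  using ord_rel_infinite by (metis finite.emptyI ex_in_conv)

instantiation ordinal :: (type) linorder
begin

definition less_eq_ordinal :: "'a ordinal \<Rightarrow> 'a ordinal \<Rightarrow> bool" where
  "x \<le> y \<longleftrightarrow> (Rep_ordinal x, Rep_ordinal y) \<in> ord_rel"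

definition less_ordinal :: "'a ordinal \<Rightarrow> 'a ordinal \<Rightarrow> bool" where
  "(x :: 'a ordinal) < y \<longleftrightarrow> x \<le> y \<and> x \<noteq> y"

instance
proof
  note W = ord_rel_Well_order[unfolded well_order_on_def linear_order_on_def
      partial_order_on_def preorder_on_def]
  fix x y z :: "'a ordinal"
  show refl: "x \<le> x"
    using W Rep_ordinal[of x] unfolding less_eq_ordinal_def by (metis refl_onD)
  show "x \<le> y \<Longrightarrow> y \<le> z \<Longrightarrow> x \<le> z"
    using W unfolding less_eq_ordinal_def by (meson transD)
  show anti: "x \<le> y \<Longrightarrow> y \<le> x \<Longrightarrow> x = y"
    using W unfolding less_eq_ordinal_def by (metis antisymD Rep_ordinal_inject)
  show "x \<le> y \<or> y \<le> x"
    using W refl Rep_ordinal[of x] Rep_ordinal[of y] Rep_ordinal_inject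
    unfolding less_eq_ordinal_def total_on_def by metis
  show "(x < y) = (x \<le> y \<and> \<not> y \<le> x)"
    unfolding less_ordinal_def using anti refl by auto
qed

end

instance ordinal :: (type) wellorder
proof
  fix P :: "'a ordinal \<Rightarrow> bool" and a :: "'a ordinal"
  assume step: "\<And>x. (\<And>y. y < x \<Longrightarrow> P y) \<Longrightarrow> P x"
  have "wf ((ord_rel :: 'a list set rel) - Id)"
    using ord_rel_Well_order unfolding well_order_on_def by blast
  hence wf: "wf (inv_image ((ord_rel :: 'a list set rel) - Id) Rep_ordinal)"
    by (rule wf_inv_image)
  show "P a"
    by (induction a rule: wf_induct_rule[OF wf])
      (rule step, simp add: inv_image_def less_ordinal_def less_eq_ordinal_def Rep_ordinal_inject)
qed

lemma bdd_above_small: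
  fixes A :: "'a ordinal set"
  assumes "|A| \<le>o |UNIV :: 'a list set|"
  shows "\<exists>\<eta>. \<forall>\<xi>\<in>A. \<xi> < \<eta>"
proof (rule ccontr)
  assume "\<not> ?thesis"
  hence unb: "\<forall>\<eta>. \<exists>\<xi>\<in>A. \<eta> \<le> \<xi>" by (meson not_less)
  have Suc_ne: "\<exists>\<zeta>. \<eta> < \<zeta>" for \<eta> :: "'a ordinal"
  proof -
    have "\<exists>b\<in>Field (ord_rel :: 'a list set rel). Rep_ordinal \<eta> \<noteq> b \<and> (Rep_ordinal \<eta>, b) \<in> ord_rel"
      by (rule infinite_Card_order_limit[OF ord_rel_Card_order ord_rel_infinite Rep_ordinal])
    thus ?thesis
      by (metis less_eq_ordinal_def less_ordinal_def Rep_ordinal_cases)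
  qed
  have "cofinal (Rep_ordinal ` A) (ord_rel :: 'a list set rel)"
    unfolding cofinal_def
  proof
    fix a assume "a \<in> Field (ord_rel :: 'a list set rel)"
    then obtain \<eta> :: "'a ordinal" where a: "a = Rep_ordinal \<eta>" by (metis Rep_ordinal_cases)
    obtain \<zeta> where "\<eta> < \<zeta>" using Suc_ne by blast
    moreover obtain \<xi> where "\<xi> \<in> A" "\<zeta> \<le> \<xi>" using unb by blast
    ultimately have "\<eta> \<le> \<xi>" "\<eta> \<noteq> \<xi>" by auto
    thus "\<exists>b\<in>Rep_ordinal ` A. a \<noteq> b \<and> (a, b) \<in> ord_rel"
      using \<open>\<xi> \<in> A\<close> a by (auto simp: less_eq_ordinal_def Rep_ordinal_inject)
  qed
  moreover have "regularCard (ord_rel :: 'a list set rel)"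
    by (rule infinite_cardSuc_regularCard)
      (simp_all add: card_of_card_order_on Field_card_of infinite_UNIV_listI)
  ultimately have "|Rep_ordinal ` A| =o (ord_rel :: 'a list set rel)"
    unfolding regularCard_def using Rep_ordinal by blast
  moreover have "|Rep_ordinal ` A| \<le>o |UNIV :: 'a list set|"
    using card_of_image assms ordLeq_transitive by blast
  moreover have "|UNIV :: 'a list set| <o (ord_rel :: 'a list set rel)"
    by (simp add: cardSuc_greater card_of_Card_order)
  ultimately show False
    by (meson not_ordLess_ordIso ordLeq_ordLess_trans)
qed

lemma lessThan_small: "|{..<\<eta>}| \<le>o |UNIV :: 'a list set|" for \<eta> :: "'a ordinal"
proof -
  have "|underS (ord_rel :: 'a list set rel) (Rep_ordinal \<eta>)| <o (ord_rel :: 'a list set rel)"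
    by (rule card_of_underS[OF ord_rel_Card_order Rep_ordinal])
  hence "|underS (ord_rel :: 'a list set rel) (Rep_ordinal \<eta>)| \<le>o |UNIV :: 'a list set|"
    by (simp add: cardSuc_ordLeq_ordLess card_of_Card_order)
  moreover have "Rep_ordinal ` {..<\<eta>} \<subseteq> underS (ord_rel :: 'a list set rel) (Rep_ordinal \<eta>)"
    by (auto simp: underS_def less_ordinal_def less_eq_ordinal_def Rep_ordinal_inject)
  hence "|{..<\<eta>}| \<le>o |underS (ord_rel :: 'a list set rel) (Rep_ordinal \<eta>)|"
    by (intro card_of_ordLeqI[where f = Rep_ordinal])
      (auto simp: inj_on_def Rep_ordinal_inject)
  ultimately show ?thesis using ordLeq_transitive by blast
qed

lemma ordinal_of_well_order:
  fixes r :: "'a list rel"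
  assumes "Well_order r"
  shows "\<exists>!\<eta> :: 'a ordinal. r =o Restr {(\<zeta>, \<xi>). \<zeta> \<le> \<xi>} {..<\<eta>}"
proof -
  define R where "R = {(\<zeta> :: 'a ordinal, \<xi>). \<zeta> \<le> \<xi>}"
  have FR: "Field R = UNIV" unfolding R_def Field_def by auto
  have minus: "R - Id = {(\<zeta>, \<xi>). \<zeta> < \<xi>}" unfolding R_def by auto
  have WR: "Well_order R"
    unfolding well_order_on_def linear_order_on_def partial_order_on_def preorder_on_def minus
    using wf by (auto simp: R_def refl_on_def trans_def antisym_def total_on_def Field_def)
  have "iso R (ord_rel :: 'a list set rel) Rep_ordinal"
    unfolding iso_iff2 FR bij_betw_def type_definition.Rep_range[OF type_definition_ordinal]
    by (simp add: R_def less_eq_ordinal_def inj_on_def Rep_ordinal_inject)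
  hence RO: "R =o (ord_rel :: 'a list set rel)"
    unfolding ordIso_def using WR ord_rel_Well_order by blast
  have "r <o (ord_rel :: 'a list set rel)"
  proof (rule ccontr)
    assume "\<not> ?thesis"
    hence "(ord_rel :: 'a list set rel) \<le>o r"
      using assms ord_rel_Well_order not_ordLess_iff_ordLeq by blast
    hence "|Field (ord_rel :: 'a list set rel)| \<le>o |Field r|" by (rule card_of_mono2)
    hence "(ord_rel :: 'a list set rel) \<le>o |Field r|"
      using card_of_Field_ordIso[OF ord_rel_Card_order] ordIso_ordLeq_trans ordIso_symmetric by blast
    hence "(ord_rel :: 'a list set rel) \<le>o |UNIV :: 'a list set|"
      using card_of_mono1[of "Field r" UNIV] ordLeq_transitive by blast
    moreover have "|UNIV :: 'a list set| <o (ord_rel :: 'a list set rel)"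
      by (simp add: cardSuc_greater card_of_Card_order)
    ultimately show False by (metis not_ordLess_ordLeq)
  qed
  hence "r <o R" using RO ordIso_symmetric ordLess_ordIso_trans by blast
  then obtain \<eta> where "r =o Restr R (underS R \<eta>)"
    using ordLess_iff_ordIso_Restr[OF WR assms] by blast
  moreover have uS: "underS R \<eta> = {..<\<eta>}" for \<eta>
    unfolding underS_def R_def by auto
  moreover have "\<eta>' = \<eta>''"
    if "r =o Restr R {..<\<eta>'}" "r =o Restr R {..<\<eta>''}" for \<eta>' \<eta>''
  proof -
    have less: "Restr R {..<x} <o Restr R {..<y}" if "x < y" for x y
      using ofilter_subset_ordLess[OF WR, of "{..<x}" "{..<y}"] that
        wo_rel.underS_ofilter[of R] WR uS by (auto simp: wo_rel_def)
    show ?thesis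
      using that less[of \<eta>' \<eta>''] less[of \<eta>'' \<eta>']
      by (metis linorder_neqE not_ordLess_ordIso ordIso_symmetric ordIso_transitive)
  qed
  ultimately show ?thesis unfolding R_def by auto
qed

instantiation ordinal :: (type) conditionally_complete_linorder
begin

definition inf_ordinal :: "'a ordinal \<Rightarrow> 'a ordinal \<Rightarrow> 'a ordinal" where "inf_ordinal = min"
definition sup_ordinal :: "'a ordinal \<Rightarrow> 'a ordinal \<Rightarrow> 'a ordinal" where "sup_ordinal = max"
definition Inf_ordinal :: "'a ordinal set \<Rightarrow> 'a ordinal" where
  "Inf (A :: 'a ordinal set) = (LEAST \<xi>. \<xi> \<in> A)"
definition Sup_ordinal :: "'a ordinal set \<Rightarrow> 'a ordinal" where
  "Sup (A :: 'a ordinal set) = (LEAST \<eta>. \<forall>\<xi>\<in>A. \<xi> \<le> \<eta>)"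

instance
proof
  fix x z :: "'a ordinal" and A
  show "x \<in> A \<Longrightarrow> bdd_below A \<Longrightarrow> Inf A \<le> x"
    unfolding Inf_ordinal_def by (rule Least_le)
  show "A \<noteq> {} \<Longrightarrow> (\<And>x. x \<in> A \<Longrightarrow> z \<le> x) \<Longrightarrow> z \<le> Inf A"
    unfolding Inf_ordinal_def by (rule LeastI2_ex) auto
  show "x \<in> A \<Longrightarrow> bdd_above A \<Longrightarrow> x \<le> Sup A"
    unfolding Sup_ordinal_def bdd_above_def by (rule LeastI2_ex) auto
  show "A \<noteq> {} \<Longrightarrow> (\<And>x. x \<in> A \<Longrightarrow> x \<le> z) \<Longrightarrow> Sup A \<le> z"
    unfolding Sup_ordinal_def by (rule Least_le) blast
qed (auto simp: inf_ordinal_def sup_ordinal_def)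

end

definition osucc :: "'a ordinal \<Rightarrow> 'a ordinal" where
  "osucc \<xi> = (LEAST \<eta>. \<xi> < \<eta>)"

instantiation ordinal :: (type) "{zero, one}"
begin
definition zero_ordinal :: "'a ordinal" where "(0 :: 'a ordinal) = (LEAST \<xi>. True)"
definition one_ordinal :: "'a ordinal" where "(1 :: 'a ordinal) = osucc 0"
instance ..
end

lemma ordinal_zero_le [simp]: "0 \<le> \<xi>" for \<xi> :: "'a ordinal"
  unfolding zero_ordinal_def by (simp add: Least_le)

lemma less_osucc [simp]: "\<xi> < osucc \<xi>"
proof -
  have "|{\<xi>}| \<le>o |UNIV :: 'a list set|"
    by (simp add: card_of_singl_ordLeq)
  from bdd_above_small[OF this] show ?thesis
    unfolding osucc_def by (auto intro: LeastI)
qed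

lemma osucc_le_iff: "osucc \<xi> \<le> \<eta> \<longleftrightarrow> \<xi> < \<eta>"
  using less_osucc[of \<xi>] unfolding osucc_def by (meson Least_le less_le_trans)

lemma osucc_inject [simp]: "osucc \<xi> = osucc \<eta> \<longleftrightarrow> \<xi> = \<eta>"
  by (metis less_osucc osucc_le_iff leD linorder_neqE)

lemma osucc_not_zero [simp]: "osucc \<xi> \<noteq> 0"
  by (metis less_osucc ordinal_zero_le leD)

definition limit_ordinal :: "'a ordinal \<Rightarrow> bool" where
  "limit_ordinal \<xi> \<longleftrightarrow> \<xi> \<noteq> 0 \<and> (\<forall>\<zeta>. \<xi> \<noteq> osucc \<zeta>)"

text \<open>
  Transfinite recursion with value \<open>z\<close> at zero, step \<open>s\<close> at successors, and at limits the
  function \<open>l\<close> applied to the set of all earlier values; see \<open>orec_zero\<close>, \<open>orec_osucc\<close>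
  and \<open>orec_limit\<close>.
\<close>

function orec :: "'b \<Rightarrow> ('b \<Rightarrow> 'b) \<Rightarrow> ('b set \<Rightarrow> 'b) \<Rightarrow> 'a ordinal \<Rightarrow> 'b" where
  "orec z s l \<xi> =
     (if \<xi> = 0 then z
      else if \<exists>\<zeta>. \<xi> = osucc \<zeta> then s (orec z s l (THE \<zeta>. \<xi> = osucc \<zeta>))
      else l (orec z s l ` {..<\<xi>}))"
  by auto
termination
  by (relation "inv_image {(\<zeta>, \<xi>). \<zeta> < \<xi>} (\<lambda>(z, s, l, \<xi>). \<xi>)")
    (rule wf_inv_image[OF wf], auto)

declare orec.simps [simp del]

lemma orec_zero: "orec z s l 0 = z"
  by (simp add: orec.simps)

lemma orec_osucc: "orec z s l (osucc \<xi>) = s (orec z s l \<xi>)"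
  by (simp add: orec.simps[of z s l "osucc \<xi>"])

lemma orec_limit: "limit_ordinal \<xi> \<Longrightarrow> orec z s l \<xi> = l (orec z s l ` {..<\<xi>})"
  by (simp add: orec.simps[of z s l \<xi>] limit_ordinal_def)

instantiation ordinal :: (type) "{plus, times}"
begin
definition plus_ordinal :: "'a ordinal \<Rightarrow> 'a ordinal \<Rightarrow> 'a ordinal" where
  "\<alpha> + \<beta> = orec \<alpha> osucc Sup \<beta>"
definition times_ordinal :: "'a ordinal \<Rightarrow> 'a ordinal \<Rightarrow> 'a ordinal" where
  "\<alpha> * \<beta> = orec 0 (\<lambda>\<gamma>. \<gamma> + \<alpha>) Sup \<beta>"
instance ..
end

definition omega :: "'a ordinal" where
  "omega = (LEAST \<xi>. limit_ordinal \<xi>)"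

definition omega_pow :: "'a ordinal \<Rightarrow> 'a ordinal" where
  "omega_pow \<beta> = orec 1 (\<lambda>\<gamma>. \<gamma> * omega) Sup \<beta>"

text \<open>Ordinals together with \<open>\<infinity>\<close>, the range of the order of a tree.\<close>

datatype 'a xordinal = Ord "'a ordinal" | Infty

instantiation xordinal :: (type) linorder
begin

definition less_eq_xordinal :: "'a xordinal \<Rightarrow> 'a xordinal \<Rightarrow> bool" where
  "x \<le> y \<longleftrightarrow> (case y of Infty \<Rightarrow> True
     | Ord \<eta> \<Rightarrow> (case x of Infty \<Rightarrow> False | Ord \<xi> \<Rightarrow> \<xi> \<le> \<eta>))"

definition less_xordinal :: "'a xordinal \<Rightarrow> 'a xordinal \<Rightarrow> bool" where
  "(x :: 'a xordinal) < y \<longleftrightarrow> x \<le> y \<and> \<not> y \<le> x"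

instance
  by standard (auto simp: less_eq_xordinal_def less_xordinal_def split: xordinal.splits)

end

lemma xordinal_simps [simp]:
  "x \<le> Infty" "\<not> Infty \<le> Ord \<xi>" "Ord \<xi> \<le> Ord \<eta> \<longleftrightarrow> \<xi> \<le> \<eta>"
  "Ord \<xi> < Infty" "\<not> Infty < x" "Ord \<xi> < Ord \<eta> \<longleftrightarrow> \<xi> < \<eta>"
  by (auto simp: less_eq_xordinal_def less_xordinal_def split: xordinal.splits)

instance xordinal :: (type) wellorder
proof
  fix P :: "'a xordinal \<Rightarrow> bool" and a :: "'a xordinal"
  assume step: "\<And>x. (\<And>y. y < x \<Longrightarrow> P y) \<Longrightarrow> P x"
  have *: "P (Ord \<xi>)" for \<xi>
  proof (induction \<xi> rule: less_induct)
    case (less \<xi>)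
    show ?case
    proof (rule step)
      fix y assume "y < Ord \<xi>"
      thus "P y" using less by (cases y) auto
    qed
  qed
  show "P a"
  proof (cases a)
    case Infty
    show ?thesis unfolding Infty
    proof (rule step)
      fix y assume "y < (Infty :: 'a xordinal)"
      thus "P y" using * by (cases y) auto
    qed
  qed (simp add: *)
qed

instantiation xordinal :: (type) complete_linorder
begin

definition bot_xordinal :: "'a xordinal" where "bot = Ord 0"
definition top_xordinal :: "'a xordinal" where "top = Infty"
definition inf_xordinal :: "'a xordinal \<Rightarrow> 'a xordinal \<Rightarrow> 'a xordinal" where "inf_xordinal = min"
definition sup_xordinal :: "'a xordinal \<Rightarrow> 'a xordinal \<Rightarrow> 'a xordinal" where "sup_xordinal = max"
definition Inf_xordinal :: "'a xordinal set \<Rightarrow> 'a xordinal" where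
  "Inf A = (LEAST x. x \<in> insert Infty A)"
definition Sup_xordinal :: "'a xordinal set \<Rightarrow> 'a xordinal" where
  "Sup (A :: 'a xordinal set) = (LEAST y. \<forall>x\<in>A. x \<le> y)"

instance
proof
  fix x z :: "'a xordinal" and A
  show 1: "x \<in> A \<Longrightarrow> Inf A \<le> x" for x :: "'a xordinal" and A
    unfolding Inf_xordinal_def by (rule Least_le) simp
  show 2: "(\<And>x. x \<in> A \<Longrightarrow> z \<le> x) \<Longrightarrow> z \<le> Inf A" for z :: "'a xordinal" and A
    unfolding Inf_xordinal_def by (rule LeastI2[of _ Infty]) auto
  show 3: "x \<in> A \<Longrightarrow> x \<le> Sup A" for x :: "'a xordinal" and A
    unfolding Sup_xordinal_def by (rule LeastI2[of _ Infty]) auto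
  show 4: "(\<And>x. x \<in> A \<Longrightarrow> x \<le> z) \<Longrightarrow> Sup A \<le> z" for z :: "'a xordinal" and A
    unfolding Sup_xordinal_def by (rule Least_le) blast
  show "Inf {} = (top :: 'a xordinal)"
    unfolding Inf_xordinal_def top_xordinal_def by (simp add: Least_equality)
  show "Sup {} = (bot :: 'a xordinal)"
    unfolding Sup_xordinal_def bot_xordinal_def
    by (rule Least_equality) (simp_all add: less_eq_xordinal_def split: xordinal.splits)
qed (auto simp: inf_xordinal_def sup_xordinal_def)

end

instantiation xordinal :: (type) times
begin
definition times_xordinal :: "'a xordinal \<Rightarrow> 'a xordinal \<Rightarrow> 'a xordinal" where
  "x * y = (case (x, y) of (Ord \<xi>, Ord \<eta>) \<Rightarrow> Ord (\<xi> * \<eta>) | _ \<Rightarrow> Infty)"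
instance ..
end


section \<open>Trees\<close>

definition derived_tree :: "'v list set \<Rightarrow> 'v list set" where
  "derived_tree T = T - {t \<in> T. \<forall>s\<in>T. prefix t s \<longrightarrow> s = t}"

definition derived_tree_iter :: "'a ordinal \<Rightarrow> 'v list set \<Rightarrow> 'v list set" where
  "derived_tree_iter \<xi> T = orec T derived_tree Inter \<xi>"

text \<open>
  \<open>'a ordinal\<close> is large enough for a tree \<open>T :: 'v list set\<close> whenever \<open>|'v list|\<close> is at most
  \<open>|'a list|\<close>: by \<open>tree_order_Infty\<close>, the value \<open>Infty\<close> then means that the derived trees never
  become empty, and not merely that \<open>'a ordinal\<close> is too short. In the statement about direct
  sums, \<open>'a\<close> is chosen accordingly.
\<close>

definition tree_order :: "'v list set \<Rightarrow> 'a xordinal" where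
  "tree_order T =
     (if \<exists>\<xi> :: 'a ordinal. derived_tree_iter \<xi> T = {}
      then Ord (LEAST \<xi>. derived_tree_iter \<xi> T = {}) else Infty)"

lemma derived_tree_iter_antimono:
  "\<zeta> \<le> \<xi> \<Longrightarrow> derived_tree_iter \<xi> T \<subseteq> derived_tree_iter \<zeta> T"
proof (induction \<xi> arbitrary: \<zeta> rule: less_induct)
  case (less \<xi>)
  consider "\<zeta> = \<xi>" | \<eta> where "\<zeta> < \<xi>" "\<xi> = osucc \<eta>" | "\<zeta> < \<xi>" "limit_ordinal \<xi>"
    using less.prems ordinal_zero_le[of \<zeta>] unfolding limit_ordinal_def
    by (metis order.not_eq_order_implies_strict leD)
  thus ?case
  proof cases
    case 2
    hence "\<zeta> \<le> \<eta>" by (metis osucc_le_iff not_less)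
    hence "derived_tree_iter \<eta> T \<subseteq> derived_tree_iter \<zeta> T"
      using less.IH[of \<eta> \<zeta>] 2 by simp
    thus ?thesis
      using 2 by (auto simp: derived_tree_iter_def orec_osucc derived_tree_def)
  next
    case 3
    thus ?thesis by (auto simp: derived_tree_iter_def orec_limit)
  qed simp
qed

lemma tree_order_Infty:
  fixes T :: "'v list set"
  assumes "|UNIV :: 'v list set| \<le>o |UNIV :: 'a list set|"
    and "tree_order T = (Infty :: 'a xordinal)"
  shows "\<exists>S. S \<subseteq> T \<and> S \<noteq> {} \<and> derived_tree S = S"
proof -
  let ?d = "\<lambda>\<xi> :: 'a ordinal. derived_tree_iter \<xi> T"
  have ne: "?d \<xi> \<noteq> {}" for \<xi>
    using assms(2) unfolding tree_order_def by (meson xordinal.distinct(1))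
  have "\<exists>\<xi>. ?d (osucc \<xi>) = ?d \<xi>"
  proof (rule ccontr)
    assume "\<not> ?thesis"
    hence "\<exists>t. t \<in> ?d \<xi> \<and> t \<notin> ?d (osucc \<xi>)" for \<xi>
      using derived_tree_iter_antimono[of \<xi> "osucc \<xi>" T] less_osucc[of \<xi>]
      by (meson less_imp_le subset_antisym subsetI)
    then obtain t where t: "\<And>\<xi>. t \<xi> \<in> ?d \<xi>" "\<And>\<xi>. t \<xi> \<notin> ?d (osucc \<xi>)" by metis
    have "t \<xi> \<noteq> t \<zeta>" if "\<zeta> < \<xi>" for \<zeta> \<xi>
      using that t(1)[of \<xi>] t(2)[of \<zeta>] derived_tree_iter_antimono[of "osucc \<zeta>" \<xi> T]
      by (auto simp: osucc_le_iff)
    hence "inj t" by (metis injI linorder_neqE)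
    hence "|UNIV :: 'a ordinal set| \<le>o |UNIV :: 'v list set|"
      by (intro card_of_ordLeqI) auto
    from bdd_above_small[OF ordLeq_transitive[OF this assms(1)]] show False by auto
  qed
  then obtain \<xi> where "derived_tree (?d \<xi>) = ?d \<xi>"
    by (auto simp: derived_tree_iter_def orec_osucc)
  moreover have "?d \<xi> \<subseteq> T"
    using derived_tree_iter_antimono[of 0 \<xi> T] by (simp add: derived_tree_iter_def orec_zero)
  ultimately show ?thesis using ne by blast
qed


section \<open>Banach spaces\<close>

text \<open>
  To have families of different Banach spaces, and to cover real and complex scalars at once, a
  normed space is a linear subspace \<open>vecs\<close> of some vector space type with its own scalar
  multiplication and its own norm (which matters on \<open>vecs\<close> only). Any family of
  vector spaces embeds into a single vector space, so this is no restriction. The sort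
  \<open>{real_normed_field, euclidean_space}\<close> used for scalars is inhabited by exactly the
  fields of real and of complex numbers.
\<close>

record ('k, 'v) nspace =
  vecs :: "'v set"
  smult :: "'k \<Rightarrow> 'v \<Rightarrow> 'v"
  nrm :: "'v \<Rightarrow> real"

definition banach_space ::
  "('k::{real_normed_field, euclidean_space}, 'v::ab_group_add) nspace \<Rightarrow> bool" where
  "banach_space X \<longleftrightarrow>
     vector_space (smult X) \<and> module.subspace (smult X) (vecs X) \<and>
     (\<forall>x\<in>vecs X. nrm X x \<ge> 0 \<and> (nrm X x = 0 \<longleftrightarrow> x = 0)) \<and>
     (\<forall>c. \<forall>x\<in>vecs X. nrm X (smult X c x) = norm c * nrm X x) \<and>
     (\<forall>x\<in>vecs X. \<forall>y\<in>vecs X. nrm X (x + y) \<le> nrm X x + nrm X y) \<and>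
     (\<forall>f :: nat \<Rightarrow> 'v. range f \<subseteq> vecs X \<longrightarrow>
        (\<forall>\<epsilon>>0. \<exists>N. \<forall>m\<ge>N. \<forall>n\<ge>N. nrm X (f m - f n) < \<epsilon>) \<longrightarrow>
        (\<exists>x\<in>vecs X. (\<lambda>n. nrm X (f n - x)) \<longlonglongrightarrow> 0))"

text \<open>Convergence in norm of the unordered series \<open>\<Sum>\<^sub>e a\<^sub>e e\<close> over \<open>e \<in> E\<close>.\<close>

definition sums_to ::
  "('k, 'u::ab_group_add) nspace \<Rightarrow> 'u set \<Rightarrow> ('u \<Rightarrow> 'k) \<Rightarrow> 'u \<Rightarrow> bool" where
  "sums_to U E a u \<longleftrightarrow>
     ((\<lambda>F. nrm U ((\<Sum>e\<in>F. smult U (a e) e) - u)) \<longlongrightarrow> 0) (finite_subsets_at_top E)"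

text \<open>
  Over the complex numbers, \<open>1\<close>-unconditionality refers to all unimodular scalars \<open>\<epsilon>\<^sub>e\<close>, over
  the reals to signs. The basis is not required to be normalised, countable or ordered.
\<close>

definition one_unconditional_basis ::
  "('k::{real_normed_field, euclidean_space}, 'u::ab_group_add) nspace \<Rightarrow> 'u set \<Rightarrow> bool" where
  "one_unconditional_basis U E \<longleftrightarrow>
     E \<subseteq> vecs U \<and>
     (\<forall>u\<in>vecs U. \<exists>!a. (\<forall>e. e \<notin> E \<longrightarrow> a e = 0) \<and> sums_to U E a u) \<and>
     (\<forall>F a \<epsilon>. finite F \<longrightarrow> F \<subseteq> E \<longrightarrow> (\<forall>e\<in>F. norm (\<epsilon> e) = 1) \<longrightarrow>
        nrm U (\<Sum>e\<in>F. smult U (\<epsilon> e * a e) e) = nrm U (\<Sum>e\<in>F. smult U (a e) e))"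

text \<open>
  The direct sum \<open>X\<^sub>E\<close>. A family over \<open>E\<close> is a function that vanishes off \<open>E\<close>.
\<close>

definition direct_sum ::
  "('k::{real_normed_field, euclidean_space}, 'u::ab_group_add) nspace \<Rightarrow> 'u set \<Rightarrow>
   ('u \<Rightarrow> ('k, 'x::ab_group_add) nspace) \<Rightarrow> ('k, 'u \<Rightarrow> 'x) nspace" where
  "direct_sum U E X =
     \<lparr>vecs = {x. (\<forall>e\<in>E. x e \<in> vecs (X e)) \<and> (\<forall>e. e \<notin> E \<longrightarrow> x e = 0) \<and>
                 (\<exists>u\<in>vecs U. sums_to U E (\<lambda>e. of_real (nrm (X e) (x e))) u)},
      smult = (\<lambda>c x e. if e \<in> E then smult (X e) c (x e) else 0),
      nrm = (\<lambda>x. nrm U (THE u. u \<in> vecs U \<and>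
                 sums_to U E (\<lambda>e. of_real (nrm (X e) (x e))) u))\<rparr>"


section \<open>The indices\<close>

definition lp_norm :: "ennreal \<Rightarrow> nat \<Rightarrow> (nat \<Rightarrow> 'k::real_normed_vector) \<Rightarrow> real" where
  "lp_norm p n a =
     (if p = \<infinity> then Max (insert 0 ((\<lambda>i. norm (a i)) ` {..<n}))
      else (\<Sum>i<n. norm (a i) powr enn2real p) powr (1 / enn2real p))"

definition T_tree ::
  "ennreal \<Rightarrow> ('k::real_normed_vector, 'v::ab_group_add) nspace \<Rightarrow> real \<Rightarrow> 'v list set" where
  "T_tree p X K =
     {xs. (\<forall>x\<in>set xs. x \<in> vecs X \<and> nrm X x \<le> 1) \<and>
          (\<forall>a. lp_norm p (length xs) a = 1 \<longrightarrow>
             inverse K \<le> nrm X (\<Sum>i<length xs. smult X (a i) (xs ! i)) \<and>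
             nrm X (\<Sum>i<length xs. smult X (a i) (xs ! i)) \<le> 1)}"

definition I_index_at ::
  "ennreal \<Rightarrow> ('k::real_normed_vector, 'v::ab_group_add) nspace \<Rightarrow> real \<Rightarrow> 'a xordinal" where
  "I_index_at p X K = tree_order (T_tree p X K)"

definition I_index ::
  "ennreal \<Rightarrow> ('k::real_normed_vector, 'v::ab_group_add) nspace \<Rightarrow> 'a xordinal" where
  "I_index p X = (SUP K\<in>{1..}. I_index_at p X K)"

unbundle no cardinal_syntax

end

theory Submission
  imports Defs
begin

text \<open>
  Write \<open>W = \<omega>\<^bsup>\<omega>\<^sup>\<alpha>\<^esup>\<close>. If the tree of \<open>\<ell>\<^sub>p\<close> sequences of \<open>X\<^sub>E\<close> with constant \<open>K\<close> has order
  exceeding \<open>W \<cdot> \<xi>\<close>, a tree of order exceeding \<open>\<xi>\<close> is produced in \<open>U\<close> with any constant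
  \<open>C > K\<close>; with \<open>\<xi> = I\<^sub>p(U, C)\<close> this is a contradiction.

  The natural map \<open>x \<mapsto> \<Sum>\<^sub>e \<parallel>x\<^sub>e\<parallel> e\<close> into \<open>U\<close> preserves norms but is not linear. For vectors with
  disjoint supports, however, it commutes with linear combinations up to unimodular changes of
  coefficients in \<open>U\<close>, and these leave the norm unchanged by \<open>1\<close>-unconditionality; so it preserves
  the norms of their linear combinations (\<open>nrm_comb_flatten\<close>). Therefore one passes to
  \<open>\<ell>\<^sub>p\<close>-normalised blocks that are small perturbations of vectors with finite disjoint supports.
  The supports used so far lie in a finite set \<open>F \<subseteq> E\<close>, and the next block has to be almost
  zero on \<open>F\<close>; truncating it to a finite set outside \<open>F\<close> then gives the next disjointly
  supported vector (\<open>nearby_finitely_supported\<close>).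

  Such blocks exist in every tree of order exceeding \<open>W\<close> (\<open>small_coordinates\<close>). For a single
  coordinate, a tree without a block that is small there projects to an \<open>\<ell>\<^sub>p\<close> tree of \<open>X\<^sub>e\<close>,
  whose order is less than \<open>W\<close> (\<open>small_coordinate\<close>). Finitely many coordinates are handled by
  blocks of blocks, at the cost of multiplying the orders, and \<open>W\<close> is closed under
  multiplication (\<open>mult_less_omega_pow_omega_pow\<close>). The errors in one coordinate must be summable
  along a sequence of blocks, which involves the trees of \<open>X\<^sub>e\<close> for infinitely many constants
  at once; hence the assumption \<open>I\<^sub>p(X\<^sub>e) < W\<close>. For \<open>p = 1\<close> a single error suffices, and
  \<open>I\<^sub>1(X\<^sub>e) \<le> W\<close> bounds the order for each constant by \<open>W\<close>, hence strictly by \<open>W\<close>, as the order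
  of a tree is never a limit ordinal (\<open>tree_order_less_limit\<close>).

  Both the passage to blocks with one small coordinate and the passage to \<open>U\<close> are instances of
  one principle on derived trees, \<open>derived_tree_iter_blocks\<close>: if acceptable blocks are found in
  trees of order exceeding \<open>\<mu>\<close>, then a tree of order exceeding \<open>\<mu> \<cdot> \<xi>\<close> has a tree of acceptable
  block sequences of order exceeding \<open>\<xi>\<close>.
\<close>


section \<open>Ordinal arithmetic\<close>

lemma bdd_above_image_lessThan: "bdd_above (f ` {..<\<xi>})"
  for f :: "'a ordinal \<Rightarrow> 'a ordinal"
proof -
  obtain \<eta> where "\<forall>\<zeta>\<in>f ` {..<\<xi>}. \<zeta> < \<eta>"
    using bdd_above_small[OF ordLeq_transitive[OF card_of_image lessThan_small]] by blast
  then show ?thesis by (auto simp: bdd_above_def intro: less_imp_le)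
qed

lemma less_osucc_iff: "\<zeta> < osucc \<xi> \<longleftrightarrow> \<zeta> \<le> \<xi>"
  by (metis osucc_le_iff not_less)

lemma zero_less_ordinal_iff: "0 < \<xi> \<longleftrightarrow> \<xi> \<noteq> 0" for \<xi> :: "'a ordinal"
  by (metis ordinal_zero_le less_le)

lemma not_less_zero_ordinal: "\<not> \<xi> < 0" for \<xi> :: "'a ordinal"
  by (simp add: leD)

lemma osucc_less_limit: "limit_ordinal \<xi> \<Longrightarrow> \<zeta> < \<xi> \<Longrightarrow> osucc \<zeta> < \<xi>"
  by (metis limit_ordinal_def osucc_le_iff order.not_eq_order_implies_strict)

lemma limit_ordinal_pos: "limit_ordinal \<xi> \<Longrightarrow> 0 < \<xi>"
  by (simp add: limit_ordinal_def zero_less_ordinal_iff)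

lemma ordinal_induct [case_names zero osucc limit]:
  fixes \<xi> :: "'a ordinal"
  assumes "P 0"
    and "\<And>\<xi>. P \<xi> \<Longrightarrow> P (osucc \<xi>)"
    and "\<And>\<xi>. limit_ordinal \<xi> \<Longrightarrow> (\<And>\<zeta>. \<zeta> < \<xi> \<Longrightarrow> P \<zeta>) \<Longrightarrow> P \<xi>"
  shows "P \<xi>"
proof (induction \<xi> rule: less_induct)
  case (less \<xi>)
  then show ?case
    using assms less_osucc unfolding limit_ordinal_def by metis
qed

lemma orec_limit_le:
  fixes z :: "'a ordinal" and \<xi> :: "'a ordinal"
  assumes "limit_ordinal \<xi>" "\<And>\<zeta>. \<zeta> < \<xi> \<Longrightarrow> orec z s Sup \<zeta> \<le> M"
  shows "orec z s Sup \<xi> \<le> M"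
  unfolding orec_limit[OF assms(1)]
  by (rule cSup_least) (use assms limit_ordinal_pos in auto)

lemma orec_mono:
  fixes z :: "'a ordinal" and \<xi> :: "'a ordinal"
  assumes "\<And>\<gamma>. \<gamma> \<le> s \<gamma>" and "\<zeta> \<le> \<xi>"
  shows "orec z s Sup \<zeta> \<le> orec z s Sup \<xi>"
  using assms(2)
proof (induction \<xi> rule: ordinal_induct)
  case zero
  then show ?case by (metis order.antisym ordinal_zero_le order.refl)
next
  case (osucc \<xi>)
  then show ?case
    by (metis assms(1) less_osucc_iff order.trans order.order_iff_strict orec_osucc)
next
  case (limit \<xi>)
  show ?case
  proof (cases "\<zeta> = \<xi>")
    case False
    then have "orec z s Sup \<zeta> \<in> orec z s Sup ` {..<\<xi>}" using limit by auto
    then show ?thesis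
      unfolding orec_limit[OF limit(1), of z s Sup]
      by (intro cSup_upper bdd_above_image_lessThan)
  qed simp
qed

lemma orec_strict_mono:
  fixes z :: "'a ordinal" and \<xi> :: "'a ordinal"
  assumes "\<And>\<gamma>. \<gamma> \<le> s \<gamma>" and "orec z s Sup \<zeta> < s (orec z s Sup \<zeta>)" and "\<zeta> < \<xi>"
  shows "orec z s Sup \<zeta> < orec z s Sup \<xi>"
  using orec_mono[of s "osucc \<zeta>" \<xi> z] assms by (simp add: orec_osucc osucc_le_iff)

text \<open>
  Functions defined by monotone recursion with suprema at limits are continuous. In the inductive
  proofs below this is what the limit steps need when the recursion variable is itself the value
  of such a function.
\<close>

lemma orec_Sup_le:
  fixes z :: "'a ordinal" and A :: "'a ordinal set"
  assumes "\<And>\<gamma>. \<gamma> \<le> s \<gamma>" and "A \<noteq> {}" "bdd_above A"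
    and le: "\<And>\<xi>. \<xi> \<in> A \<Longrightarrow> orec z s Sup \<xi> \<le> M"
  shows "orec z s Sup (Sup A) \<le> M"
proof (cases "Sup A \<in> A")
  case False
  then have less: "\<xi> < Sup A" if "\<xi> \<in> A" for \<xi>
    using that assms(3) by (metis cSup_upper order.not_eq_order_implies_strict)
  have "limit_ordinal (Sup A)"
    unfolding limit_ordinal_def
  proof (intro conjI allI notI)
    assume "Sup A = 0"
    then show False using less assms(2) not_less_zero_ordinal by (metis ex_in_conv)
  next
    fix \<zeta> assume eq: "Sup A = osucc \<zeta>"
    then have "Sup A \<le> \<zeta>" using less assms(2) by (intro cSup_least) (auto simp: less_osucc_iff)
    then show False using eq less_osucc leD by metis
  qed
  then show ?thesis
  proof (rule orec_limit_le)
    fix \<zeta> assume "\<zeta> < Sup A"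
    then obtain \<xi> where "\<xi> \<in> A" "\<zeta> < \<xi>" using less_cSupE[OF _ assms(2)] by blast
    then show "orec z s Sup \<zeta> \<le> M"
      using orec_mono[OF assms(1), of \<zeta> \<xi> z] le by fastforce
  qed
qed (rule le)

lemma ordinal_add_zero: "\<alpha> + 0 = \<alpha>" for \<alpha> :: "'a ordinal"
  by (simp add: plus_ordinal_def orec_zero)

lemma ordinal_add_osucc: "\<alpha> + osucc \<beta> = osucc (\<alpha> + \<beta>)"
  by (simp add: plus_ordinal_def orec_osucc)

lemma ordinal_add_limit_le:
  fixes \<alpha> :: "'a ordinal"
  shows "limit_ordinal \<beta> \<Longrightarrow> (\<And>\<zeta>. \<zeta> < \<beta> \<Longrightarrow> \<alpha> + \<zeta> \<le> M) \<Longrightarrow> \<alpha> + \<beta> \<le> M"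
  unfolding plus_ordinal_def by (rule orec_limit_le)

lemma ordinal_add_Sup_le:
  fixes \<alpha> :: "'a ordinal"
  shows "A \<noteq> {} \<Longrightarrow> bdd_above A \<Longrightarrow> (\<And>\<xi>. \<xi> \<in> A \<Longrightarrow> \<alpha> + \<xi> \<le> M) \<Longrightarrow> \<alpha> + Sup A \<le> M"
  unfolding plus_ordinal_def by (rule orec_Sup_le) (simp_all add: less_imp_le)

lemma ordinal_add_mono_right: "\<beta> \<le> \<gamma> \<Longrightarrow> \<alpha> + \<beta> \<le> \<alpha> + \<gamma>" for \<alpha> :: "'a ordinal"
  unfolding plus_ordinal_def by (rule orec_mono) (simp_all add: less_imp_le)

lemma ordinal_add_strict_mono: "\<beta> < \<gamma> \<Longrightarrow> \<alpha> + \<beta> < \<alpha> + \<gamma>" for \<alpha> :: "'a ordinal"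
  unfolding plus_ordinal_def by (rule orec_strict_mono) (simp_all add: less_imp_le)

lemma ordinal_le_add: "\<alpha> \<le> \<alpha> + \<beta>" for \<alpha> :: "'a ordinal"
  using ordinal_add_mono_right[of 0 \<beta> \<alpha>] by (simp add: ordinal_add_zero)

lemma ordinal_add_mono_left: "\<alpha> \<le> \<beta> \<Longrightarrow> \<alpha> + \<gamma> \<le> \<beta> + \<gamma>" for \<alpha> :: "'a ordinal"
proof (induction \<gamma> rule: ordinal_induct)
  case (osucc \<gamma>)
  then show ?case by (simp add: ordinal_add_osucc osucc_le_iff less_osucc_iff)
next
  case (limit \<gamma>)
  then show ?case
    by (meson ordinal_add_limit_le ordinal_add_mono_right less_imp_le order.trans)
qed (simp add: ordinal_add_zero)

lemma ordinal_add_assoc_le: "(\<alpha> + \<beta>) + \<gamma> \<le> \<alpha> + (\<beta> + \<gamma>)" for \<alpha> :: "'a ordinal"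
proof (induction \<gamma> rule: ordinal_induct)
  case (limit \<gamma>)
  show ?case
  proof (rule ordinal_add_limit_le[OF limit(1)])
    fix \<zeta> assume "\<zeta> < \<gamma>"
    then show "(\<alpha> + \<beta>) + \<zeta> \<le> \<alpha> + (\<beta> + \<gamma>)"
      by (metis limit(2) ordinal_add_mono_right less_imp_le order.trans)
  qed
qed (simp_all add: ordinal_add_zero ordinal_add_osucc osucc_le_iff less_osucc_iff)

lemma ordinal_add_assoc_ge: "\<alpha> + (\<beta> + \<gamma>) \<le> (\<alpha> + \<beta>) + \<gamma>" for \<alpha> :: "'a ordinal"
proof (induction \<gamma> rule: ordinal_induct)
  case (limit \<gamma>)
  have "\<beta> + \<gamma> = Sup ((+) \<beta> ` {..<\<gamma>})"
    unfolding plus_ordinal_def by (rule orec_limit[OF limit(1)])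
  moreover have "\<alpha> + Sup ((+) \<beta> ` {..<\<gamma>}) \<le> (\<alpha> + \<beta>) + \<gamma>"
  proof (rule ordinal_add_Sup_le)
    show "(+) \<beta> ` {..<\<gamma>} \<noteq> {}" using limit_ordinal_pos[OF limit(1)] by auto
    fix \<xi> assume "\<xi> \<in> (+) \<beta> ` {..<\<gamma>}"
    then show "\<alpha> + \<xi> \<le> (\<alpha> + \<beta>) + \<gamma>"
      by (auto intro!: order.trans[OF limit(2)] ordinal_add_mono_right simp: less_imp_le)
  qed (rule bdd_above_image_lessThan)
  ultimately show ?case by simp
qed (simp_all add: ordinal_add_zero ordinal_add_osucc osucc_le_iff less_osucc_iff)

lemma ordinal_zero_add: "0 + \<alpha> = \<alpha>" for \<alpha> :: "'a ordinal"
proof (induction \<alpha> rule: ordinal_induct)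
  case (limit \<alpha>)
  have "0 + \<alpha> \<le> \<alpha>"
    by (rule ordinal_add_limit_le[OF limit(1)]) (simp add: limit(2) less_imp_le)
  moreover have "\<alpha> \<le> 0 + \<alpha>"
  proof (rule ccontr)
    assume "\<not> \<alpha> \<le> 0 + \<alpha>"
    then have *: "0 + \<alpha> < \<alpha>" by simp
    have "0 + (0 + \<alpha>) < 0 + \<alpha>" using * by (rule ordinal_add_strict_mono)
    then show False using limit(2)[OF *] by simp
  qed
  ultimately show ?case by simp
qed (simp_all add: ordinal_add_zero ordinal_add_osucc)

lemma ordinal_mult_zero: "\<alpha> * 0 = 0" for \<alpha> :: "'a ordinal"
  by (simp add: times_ordinal_def orec_zero)

lemma ordinal_mult_osucc: "\<alpha> * osucc \<beta> = \<alpha> * \<beta> + \<alpha>"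
  by (simp add: times_ordinal_def orec_osucc)

lemma ordinal_mult_one: "\<alpha> * 1 = \<alpha>" for \<alpha> :: "'a ordinal"
  by (simp add: one_ordinal_def ordinal_mult_osucc ordinal_mult_zero ordinal_zero_add)

lemma ordinal_mult_limit_le:
  fixes \<alpha> :: "'a ordinal"
  shows "limit_ordinal \<beta> \<Longrightarrow> (\<And>\<zeta>. \<zeta> < \<beta> \<Longrightarrow> \<alpha> * \<zeta> \<le> M) \<Longrightarrow> \<alpha> * \<beta> \<le> M"
  unfolding times_ordinal_def by (rule orec_limit_le)

lemma ordinal_mult_Sup_le:
  fixes \<alpha> :: "'a ordinal"
  shows "A \<noteq> {} \<Longrightarrow> bdd_above A \<Longrightarrow> (\<And>\<xi>. \<xi> \<in> A \<Longrightarrow> \<alpha> * \<xi> \<le> M) \<Longrightarrow> \<alpha> * Sup A \<le> M"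
  unfolding times_ordinal_def by (rule orec_Sup_le) (simp_all add: ordinal_le_add)

lemma ordinal_mult_mono_right: "\<beta> \<le> \<gamma> \<Longrightarrow> \<alpha> * \<beta> \<le> \<alpha> * \<gamma>" for \<alpha> :: "'a ordinal"
  unfolding times_ordinal_def by (rule orec_mono) (rule ordinal_le_add)

lemma ordinal_mult_add_le: "\<eta> < \<zeta> \<Longrightarrow> \<mu> * \<eta> + \<mu> \<le> \<mu> * \<zeta>" for \<mu> :: "'a ordinal"
  by (metis ordinal_mult_mono_right ordinal_mult_osucc osucc_le_iff)

lemma ordinal_mult_mono_left: "\<alpha> \<le> \<beta> \<Longrightarrow> \<alpha> * \<gamma> \<le> \<beta> * \<gamma>" for \<alpha> :: "'a ordinal"
proof (induction \<gamma> rule: ordinal_induct)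
  case (osucc \<gamma>)
  then show ?case
    by (metis ordinal_mult_osucc ordinal_add_mono_left ordinal_add_mono_right order.trans)
next
  case (limit \<gamma>)
  then show ?case
    by (meson ordinal_mult_limit_le ordinal_mult_mono_right less_imp_le order.trans)
qed (simp add: ordinal_mult_zero)

lemma ordinal_distrib_le: "\<alpha> * (\<beta> + \<gamma>) \<le> \<alpha> * \<beta> + \<alpha> * \<gamma>" for \<alpha> :: "'a ordinal"
proof (induction \<gamma> rule: ordinal_induct)
  case zero
  then show ?case by (simp add: ordinal_add_zero ordinal_mult_zero)
next
  case (osucc \<gamma>)
  have "\<alpha> * (\<beta> + \<gamma>) + \<alpha> \<le> (\<alpha> * \<beta> + \<alpha> * \<gamma>) + \<alpha>"
    using osucc by (rule ordinal_add_mono_left)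
  also have "\<dots> \<le> \<alpha> * \<beta> + (\<alpha> * \<gamma> + \<alpha>)" by (rule ordinal_add_assoc_le)
  finally show ?case by (simp add: ordinal_add_osucc ordinal_mult_osucc)
next
  case (limit \<gamma>)
  have "\<beta> + \<gamma> = Sup ((+) \<beta> ` {..<\<gamma>})"
    unfolding plus_ordinal_def by (rule orec_limit[OF limit(1)])
  moreover have "\<alpha> * Sup ((+) \<beta> ` {..<\<gamma>}) \<le> \<alpha> * \<beta> + \<alpha> * \<gamma>"
  proof (rule ordinal_mult_Sup_le)
    show "(+) \<beta> ` {..<\<gamma>} \<noteq> {}" using limit_ordinal_pos[OF limit(1)] by auto
    fix \<xi> assume "\<xi> \<in> (+) \<beta> ` {..<\<gamma>}"
    then show "\<alpha> * \<xi> \<le> \<alpha> * \<beta> + \<alpha> * \<gamma>"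
      using limit(2) by (auto intro!: order.trans[OF limit(2)] ordinal_add_mono_right
          ordinal_mult_mono_right simp: less_imp_le)
  qed (rule bdd_above_image_lessThan)
  ultimately show ?case by simp
qed

lemma ordinal_mult_assoc_le: "\<alpha> * (\<beta> * \<gamma>) \<le> (\<alpha> * \<beta>) * \<gamma>" for \<alpha> :: "'a ordinal"
proof (induction \<gamma> rule: ordinal_induct)
  case zero
  then show ?case by (simp add: ordinal_mult_zero)
next
  case (osucc \<gamma>)
  then show ?case
    by (metis ordinal_mult_osucc ordinal_distrib_le ordinal_add_mono_left order.trans)
next
  case (limit \<gamma>)
  have "\<beta> * \<gamma> = Sup ((*) \<beta> ` {..<\<gamma>})"
    unfolding times_ordinal_def by (rule orec_limit[OF limit(1)])
  moreover have "\<alpha> * Sup ((*) \<beta> ` {..<\<gamma>}) \<le> (\<alpha> * \<beta>) * \<gamma>"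
  proof (rule ordinal_mult_Sup_le)
    show "(*) \<beta> ` {..<\<gamma>} \<noteq> {}" using limit_ordinal_pos[OF limit(1)] by auto
    fix \<xi> assume "\<xi> \<in> (*) \<beta> ` {..<\<gamma>}"
    then show "\<alpha> * \<xi> \<le> (\<alpha> * \<beta>) * \<gamma>"
      by (auto intro!: order.trans[OF limit(2)] ordinal_mult_mono_right simp: less_imp_le)
  qed (rule bdd_above_image_lessThan)
  ultimately show ?case by simp
qed

lemma limit_ordinal_omega: "limit_ordinal (omega :: 'a ordinal)"
proof -
  define f :: "nat \<Rightarrow> 'a ordinal" where "f n = (osucc ^^ n) 0" for n
  have "ordLeq3 (card_of (range f)) (card_of (UNIV :: 'a list set))"
    using ordLeq_transitive[OF card_of_image[of f UNIV]] infinite_iff_card_of_nat infinite_UNIV_listI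
    by blast
  then have "\<exists>\<eta>. \<forall>n. f n < \<eta>" using bdd_above_small by (metis rangeI)
  define \<eta> where "\<eta> = (LEAST \<eta>. \<forall>n. f n < \<eta>)"
  have \<eta>: "f n < \<eta>" for n
    unfolding \<eta>_def using LeastI_ex[OF \<open>\<exists>\<eta>. \<forall>n. f n < \<eta>\<close>] by blast
  have "limit_ordinal \<eta>"
    unfolding limit_ordinal_def
  proof (intro conjI allI notI)
    show False if "\<eta> = 0" using \<eta>[of 0] that not_less_zero_ordinal by auto
    fix \<zeta> assume eq: "\<eta> = osucc \<zeta>"
    have "f n < \<zeta>" for n
      using \<eta>[of "Suc n"] eq less_osucc[of "f n"] by (simp add: f_def less_osucc_iff osucc_le_iff)
    then have "\<eta> \<le> \<zeta>" unfolding \<eta>_def by (intro Least_le) simp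
    then show False using eq less_osucc leD by metis
  qed
  then show ?thesis unfolding omega_def by (rule LeastI)
qed

lemma one_less_omega: "1 < (omega :: 'a ordinal)"
  by (simp add: limit_ordinal_omega limit_ordinal_pos one_ordinal_def osucc_less_limit)

lemma less_omega_induct [consumes 1, case_names zero osucc]:
  fixes \<xi> :: "'a ordinal"
  assumes "\<xi> < omega" and "P 0" and "\<And>\<xi>. \<xi> < omega \<Longrightarrow> P \<xi> \<Longrightarrow> P (osucc \<xi>)"
  shows "P \<xi>"
  using assms(1)
proof (induction \<xi> rule: ordinal_induct)
  case (osucc \<xi>)
  then show ?case using assms(3) less_osucc less_trans by blast
next
  case (limit \<xi>)
  then show ?case unfolding omega_def using not_less_Least by blast
qed (rule assms(2))

lemma add_less_omega:
  fixes \<xi> :: "'a ordinal"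
  assumes "\<xi> < omega" "\<eta> < omega"
  shows "\<xi> + \<eta> < omega"
  using assms(2)
  by (induction rule: less_omega_induct)
    (simp_all add: assms(1) ordinal_add_zero ordinal_add_osucc osucc_less_limit limit_ordinal_omega)

lemma mult_less_omega:
  fixes \<xi> :: "'a ordinal"
  assumes "\<xi> < omega" "\<eta> < omega"
  shows "\<xi> * \<eta> < omega"
  using assms(2)
  by (induction rule: less_omega_induct)
    (simp_all add: assms(1) ordinal_mult_zero ordinal_mult_osucc add_less_omega
      limit_ordinal_omega limit_ordinal_pos)

lemma omega_pow_zero: "omega_pow 0 = 1"
  by (simp add: omega_pow_def orec_zero)

lemma omega_pow_osucc: "omega_pow (osucc \<beta>) = omega_pow \<beta> * omega"
  by (simp add: omega_pow_def orec_osucc)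

lemma omega_pow_limit: "limit_ordinal \<beta> \<Longrightarrow> omega_pow \<beta> = Sup (omega_pow ` {..<\<beta>})"
  unfolding omega_pow_def by (rule orec_limit)

lemma ordinal_le_mult_omega: "\<gamma> \<le> \<gamma> * omega" for \<gamma> :: "'a ordinal"
  using ordinal_mult_mono_right[OF less_imp_le[OF one_less_omega], of \<gamma>]
  by (simp add: ordinal_mult_one)

lemma omega_pow_mono: "\<beta> \<le> \<gamma> \<Longrightarrow> omega_pow \<beta> \<le> omega_pow \<gamma>"
  unfolding omega_pow_def by (rule orec_mono) (rule ordinal_le_mult_omega)

lemma omega_pow_pos: "0 < omega_pow \<beta>"
proof -
  have "(0 :: 'a ordinal) < 1" by (simp add: one_ordinal_def)
  also have "1 \<le> omega_pow \<beta>" using omega_pow_mono[of 0 \<beta>] by (simp add: omega_pow_zero)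
  finally show ?thesis .
qed

lemma omega_pow_strict_mono:
  assumes "\<beta> < \<gamma>"
  shows "omega_pow \<beta> < omega_pow \<gamma>"
proof -
  let ?\<delta> = "omega_pow \<beta>"
  have "?\<delta> = ?\<delta> + 0" by (simp add: ordinal_add_zero)
  also have "\<dots> < ?\<delta> + ?\<delta>" by (rule ordinal_add_strict_mono[OF omega_pow_pos])
  also have "\<dots> = ?\<delta> * osucc 1" by (simp add: ordinal_mult_osucc ordinal_mult_one)
  also have "\<dots> \<le> ?\<delta> * omega"
    by (intro ordinal_mult_mono_right less_imp_le osucc_less_limit
        limit_ordinal_omega one_less_omega)
  finally have "?\<delta> < ?\<delta> * omega" .
  from orec_strict_mono[OF ordinal_le_mult_omega this[unfolded omega_pow_def] assms]
  show ?thesis by (simp add: omega_pow_def)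
qed

lemma omega_pow_mult_le: "omega_pow \<beta> * omega_pow \<gamma> \<le> omega_pow (\<beta> + \<gamma>)"
proof (induction \<gamma> rule: ordinal_induct)
  case zero
  then show ?case by (simp add: omega_pow_zero ordinal_add_zero ordinal_mult_one)
next
  case (osucc \<gamma>)
  have "omega_pow \<beta> * (omega_pow \<gamma> * omega) \<le> (omega_pow \<beta> * omega_pow \<gamma>) * omega"
    by (rule ordinal_mult_assoc_le)
  also have "\<dots> \<le> omega_pow (\<beta> + \<gamma>) * omega" using osucc by (rule ordinal_mult_mono_left)
  finally show ?case by (simp add: omega_pow_osucc ordinal_add_osucc)
next
  case (limit \<gamma>)
  have "omega_pow \<beta> * Sup (omega_pow ` {..<\<gamma>}) \<le> omega_pow (\<beta> + \<gamma>)"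
  proof (rule ordinal_mult_Sup_le)
    show "omega_pow ` {..<\<gamma>} \<noteq> {}" using limit_ordinal_pos[OF limit(1)] by auto
    fix \<xi> assume "\<xi> \<in> omega_pow ` {..<\<gamma>}"
    then show "omega_pow \<beta> * \<xi> \<le> omega_pow (\<beta> + \<gamma>)"
      by (auto intro!: order.trans[OF limit(2)] omega_pow_mono ordinal_add_mono_right
          simp: less_imp_le)
  qed (rule bdd_above_image_lessThan)
  then show ?case by (simp add: omega_pow_limit[OF limit(1)])
qed

lemma less_mult_omegaE:
  fixes \<xi> :: "'a ordinal"
  assumes "\<xi> < \<gamma> * omega"
  obtains n where "n < omega" "\<xi> < \<gamma> * n"
  using assms ordinal_mult_limit_le[OF limit_ordinal_omega, of \<gamma> \<xi>] leD not_le_imp_less by blast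

lemma add_less_omega_pow:
  assumes "\<beta> < omega_pow \<alpha>" "\<gamma> < omega_pow \<alpha>"
  shows "\<beta> + \<gamma> < omega_pow \<alpha>"
  using assms
proof (induction \<alpha> arbitrary: \<beta> \<gamma> rule: ordinal_induct)
  case zero
  then have "\<beta> = 0" "\<gamma> = 0"
    by (auto simp: omega_pow_zero one_ordinal_def less_osucc_iff intro: order.antisym)
  then show ?case by (simp add: omega_pow_pos ordinal_add_zero)
next
  case (osucc \<alpha>)
  obtain m n where mn: "m < omega" "\<beta> < omega_pow \<alpha> * m" "n < omega" "\<gamma> < omega_pow \<alpha> * n"
    using osucc.prems by (metis less_mult_omegaE omega_pow_osucc)
  have "\<beta> + \<gamma> < \<beta> + omega_pow \<alpha> * n" using mn by (intro ordinal_add_strict_mono)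
  also have "\<dots> \<le> omega_pow \<alpha> * m + omega_pow \<alpha> * n"
    using mn by (intro ordinal_add_mono_left less_imp_le)
  also have "\<dots> \<le> omega_pow \<alpha> * (m + n)"
    using mn(3)
  proof (induction n rule: less_omega_induct)
    case (osucc n)
    have "omega_pow \<alpha> * m + (omega_pow \<alpha> * n + omega_pow \<alpha>)
        \<le> (omega_pow \<alpha> * m + omega_pow \<alpha> * n) + omega_pow \<alpha>"
      by (rule ordinal_add_assoc_ge)
    also have "\<dots> \<le> omega_pow \<alpha> * (m + n) + omega_pow \<alpha>"
      by (rule ordinal_add_mono_left[OF osucc(2)])
    finally show ?case by (simp add: ordinal_mult_osucc ordinal_add_osucc)
  qed (simp add: ordinal_mult_zero ordinal_add_zero)
  also have "\<dots> \<le> omega_pow \<alpha> * omega"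
    using mn by (intro ordinal_mult_mono_right less_imp_le add_less_omega)
  finally show ?case by (simp add: omega_pow_osucc)
next
  case (limit \<alpha>)
  obtain \<delta> where \<delta>: "\<delta> < \<alpha>" "\<beta> < omega_pow \<delta>" "\<gamma> < omega_pow \<delta>"
  proof -
    obtain \<delta>1 \<delta>2 where "\<delta>1 < \<alpha>" "\<beta> < omega_pow \<delta>1" "\<delta>2 < \<alpha>" "\<gamma> < omega_pow \<delta>2"
      using limit.prems limit_ordinal_pos[OF limit(1)] unfolding omega_pow_limit[OF limit(1)]
      by (fastforce elim!: less_cSupE)
    then show thesis
      using that[of "max \<delta>1 \<delta>2"] omega_pow_mono[of _ "max \<delta>1 \<delta>2"]
      by (metis less_le_trans max.cobounded1 max.cobounded2 max_less_iff_conj)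
  qed
  have "\<beta> + \<gamma> < omega_pow \<delta>" using limit(2) \<delta> by blast
  also have "\<dots> \<le> omega_pow \<alpha>" using \<delta> by (intro omega_pow_mono less_imp_le)
  finally show ?case .
qed

lemma limit_ordinal_omega_pow:
  assumes "0 < \<beta>"
  shows "limit_ordinal (omega_pow \<beta>)"
  unfolding limit_ordinal_def
proof (intro conjI allI notI)
  show False if "omega_pow \<beta> = 0" using that omega_pow_pos[of \<beta>] by simp
  fix \<zeta> assume eq: "omega_pow \<beta> = osucc \<zeta>"
  have "1 < omega_pow \<beta>" using omega_pow_strict_mono[OF assms] by (simp add: omega_pow_zero)
  then have "\<zeta> + 1 < omega_pow \<beta>" by (intro add_less_omega_pow) (simp_all add: eq)
  then show False by (simp add: eq one_ordinal_def ordinal_add_osucc ordinal_add_zero)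
qed

text \<open>
  Exponents add up when powers of \<open>\<omega>\<close> are multiplied, and the ordinals below \<open>\<omega>\<^sup>\<alpha>\<close> are closed
  under addition; this is where double powers of \<open>\<omega>\<close> come from. The exponent \<open>\<omega>\<^sup>\<alpha>\<close> is a limit
  except for \<open>\<alpha> = 0\<close>, when the claim is that a product of two finite ordinals is finite.
\<close>

lemma mult_less_omega_pow_omega_pow:
  assumes "\<xi> < omega_pow (omega_pow \<alpha>)" "\<eta> < omega_pow (omega_pow \<alpha>)"
  shows "\<xi> * \<eta> < omega_pow (omega_pow \<alpha>)"
proof (cases "\<alpha> = 0")
  case True
  have "1 * \<zeta> = \<zeta>" for \<zeta> :: "'a ordinal"
  proof (induction \<zeta> rule: ordinal_induct)
    case (osucc \<zeta>)
    then show ?case by (simp add: ordinal_mult_osucc one_ordinal_def ordinal_add_osucc ordinal_add_zero)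
  next
    case (limit \<zeta>)
    have "1 * \<zeta> = Sup ((*) 1 ` {..<\<zeta>})"
      unfolding times_ordinal_def by (rule orec_limit[OF limit(1)])
    also have "(*) 1 ` {..<\<zeta>} = {..<\<zeta>}" using limit(2) by force
    also have "Sup {..<\<zeta>} = \<zeta>"
    proof (rule cSup_eq_non_empty)
      show "{..<\<zeta>} \<noteq> {}" using limit_ordinal_pos[OF limit(1)] by auto
      show "\<zeta> \<le> y" if "\<And>x. x \<in> {..<\<zeta>} \<Longrightarrow> x \<le> y" for y
        using that osucc_less_limit[OF limit(1)] less_osucc
        by (metis lessThan_iff leD not_le_imp_less)
    qed auto
    finally show ?case .
  qed (rule ordinal_mult_zero)
  then have "omega_pow (omega_pow \<alpha>) = omega"
    by (simp add: True omega_pow_zero) (simp add: one_ordinal_def omega_pow_osucc omega_pow_zero)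
  then show ?thesis using assms mult_less_omega by simp
next
  case False
  have lim: "limit_ordinal (omega_pow \<alpha>)"
    using False by (intro limit_ordinal_omega_pow) (simp add: zero_less_ordinal_iff)
  obtain \<beta> \<gamma> where b: "\<beta> < omega_pow \<alpha>" "\<xi> < omega_pow \<beta>" "\<gamma> < omega_pow \<alpha>" "\<eta> < omega_pow \<gamma>"
    using assms limit_ordinal_pos[OF lim] unfolding omega_pow_limit[OF lim]
    by (fastforce elim!: less_cSupE)
  have "\<xi> * \<eta> \<le> omega_pow \<beta> * omega_pow \<gamma>"
    using b by (meson ordinal_mult_mono_left ordinal_mult_mono_right less_imp_le order.trans)
  also have "\<dots> \<le> omega_pow (\<beta> + \<gamma>)" by (rule omega_pow_mult_le)
  also have "\<dots> < omega_pow (omega_pow \<alpha>)"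
    using b by (intro omega_pow_strict_mono add_less_omega_pow)
  finally show ?thesis .
qed

section \<open>Derived trees\<close>

lemma derived_tree_eq: "derived_tree T = {t \<in> T. \<exists>s\<in>T. strict_prefix t s}"
  by (auto simp: derived_tree_def strict_prefix_def)

text \<open>
  Since this rank-like description holds for arbitrary sets of sequences, it also applies to the
  sets of block sequences below, where the extension that witnesses a rank is found several
  entries at a time.
\<close>

lemma in_derived_tree_iter_iff:
  "t \<in> derived_tree_iter \<xi> T \<longleftrightarrow>
     t \<in> T \<and> (\<forall>\<zeta><\<xi>. \<exists>s\<in>derived_tree_iter \<zeta> T. strict_prefix t s)"
proof (induction \<xi> rule: ordinal_induct)
  case zero
  then show ?case
    by (simp add: derived_tree_iter_def orec_zero not_less_zero_ordinal)
next
  case (osucc \<xi>)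
  have "t \<in> derived_tree_iter (osucc \<xi>) T \<longleftrightarrow>
      t \<in> derived_tree_iter \<xi> T \<and> (\<exists>s\<in>derived_tree_iter \<xi> T. strict_prefix t s)"
    by (simp add: derived_tree_iter_def orec_osucc derived_tree_eq)
  then show ?case
    using osucc derived_tree_iter_antimono[of _ \<xi> T]
    by (auto simp: less_osucc_iff order.order_iff_strict)
next
  case (limit \<xi>)
  have "t \<in> derived_tree_iter \<xi> T \<longleftrightarrow> (\<forall>\<zeta><\<xi>. t \<in> derived_tree_iter \<zeta> T)"
    by (auto simp: derived_tree_iter_def orec_limit[OF limit(1)])
  also have "\<dots> \<longleftrightarrow> t \<in> T \<and> (\<forall>\<zeta><\<xi>. \<exists>s\<in>derived_tree_iter \<zeta> T. strict_prefix t s)"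
  proof (intro iffI conjI allI impI)
    assume *: "\<forall>\<zeta><\<xi>. t \<in> derived_tree_iter \<zeta> T"
    then show "t \<in> T" using limit limit_ordinal_pos by blast
    show "\<exists>s\<in>derived_tree_iter \<zeta> T. strict_prefix t s" if "\<zeta> < \<xi>" for \<zeta>
      using * limit(2) osucc_less_limit[OF limit(1) that] less_osucc by blast
  next
    fix \<zeta> assume *: "t \<in> T \<and> (\<forall>\<zeta><\<xi>. \<exists>s\<in>derived_tree_iter \<zeta> T. strict_prefix t s)" "\<zeta> < \<xi>"
    then show "t \<in> derived_tree_iter \<zeta> T"
      using limit(2)[OF *(2)] less_trans by blast
  qed
  finally show ?case .
qed

lemma derived_tree_iter_subset: "derived_tree_iter \<xi> T \<subseteq> T"
  using in_derived_tree_iter_iff by blast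

lemma Nil_in_derived_tree_iter:
  assumes "[] \<in> T" "derived_tree_iter \<xi> T \<noteq> {}"
  shows "[] \<in> derived_tree_iter \<xi> T"
proof -
  obtain t where t: "t \<in> derived_tree_iter \<xi> T" using assms by blast
  then have "t \<in> derived_tree_iter \<zeta> T" if "\<zeta> < \<xi>" for \<zeta>
    using derived_tree_iter_antimono[OF less_imp_le[OF that]] by blast
  then show ?thesis
    using assms t by (cases "t = []") (auto simp: in_derived_tree_iter_iff[of "[]"] strict_prefix_def)
qed

lemma derived_tree_iter_map:
  assumes "\<And>s. s \<in> S \<Longrightarrow> map f s \<in> T"
  shows "s \<in> derived_tree_iter \<xi> S \<Longrightarrow> map f s \<in> derived_tree_iter \<xi> T"
proof (induction \<xi> arbitrary: s rule: less_induct)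
  case (less \<xi>)
  show ?case
    unfolding in_derived_tree_iter_iff[of "map f s"]
  proof (intro conjI allI impI)
    show "map f s \<in> T" using less.prems derived_tree_iter_subset assms by blast
    fix \<zeta> assume "\<zeta> < \<xi>"
    then obtain s' where "s' \<in> derived_tree_iter \<zeta> S" "strict_prefix s s'"
      using less.prems in_derived_tree_iter_iff[of s \<xi> S] by blast
    moreover from this have "strict_prefix (map f s) (map f s')"
      by (auto simp: strict_prefix_def prefix_def)
    ultimately show "\<exists>s'\<in>derived_tree_iter \<zeta> T. strict_prefix (map f s) s'"
      using less.IH \<open>\<zeta> < \<xi>\<close> by blast
  qed
qed

lemma derived_tree_iter_above:
  "t @ s \<in> derived_tree_iter \<xi> T \<Longrightarrow> s \<in> derived_tree_iter \<xi> {s. t @ s \<in> T}"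
proof (induction \<xi> arbitrary: s rule: less_induct)
  case (less \<xi>)
  show ?case
    unfolding in_derived_tree_iter_iff[of s]
  proof (intro conjI allI impI)
    show "s \<in> {s. t @ s \<in> T}" using less.prems derived_tree_iter_subset by blast
    fix \<zeta> assume "\<zeta> < \<xi>"
    then obtain u where u: "u \<in> derived_tree_iter \<zeta> T" "strict_prefix (t @ s) u"
      using less.prems in_derived_tree_iter_iff[of "t @ s" \<xi> T] by blast
    then obtain r where "u = t @ (s @ r)" "r \<noteq> []"
      by (auto simp: strict_prefix_def prefix_def)
    then show "\<exists>s'\<in>derived_tree_iter \<zeta> {s. t @ s \<in> T}. strict_prefix s s'"
      using less.IH[OF \<open>\<zeta> < \<xi>\<close>, of "s @ r"] u by (intro bexI[of _ "s @ r"]) (auto simp: strict_prefix_def)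
  qed
qed

lemma derived_tree_iter_add:
  "derived_tree_iter (\<mu> + \<xi>) T \<subseteq> derived_tree_iter \<xi> (derived_tree_iter \<mu> T)"
proof (induction \<xi> rule: less_induct)
  case (less \<xi>)
  show ?case
  proof
    fix t assume t: "t \<in> derived_tree_iter (\<mu> + \<xi>) T"
    show "t \<in> derived_tree_iter \<xi> (derived_tree_iter \<mu> T)"
      unfolding in_derived_tree_iter_iff[of t \<xi>]
    proof (intro conjI allI impI)
      show "t \<in> derived_tree_iter \<mu> T"
        using t derived_tree_iter_antimono[OF ordinal_le_add] by blast
      fix \<zeta> assume "\<zeta> < \<xi>"
      then show "\<exists>s\<in>derived_tree_iter \<zeta> (derived_tree_iter \<mu> T). strict_prefix t s"
        using t less ordinal_add_strict_mono[of \<zeta> \<xi> \<mu>] in_derived_tree_iter_iff[of t _ T]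
        by blast
    qed
  qed
qed

text \<open>
  Here \<open>R t b\<close> stands for \<open>b\<close> being a sequence of acceptable blocks cut out of \<open>t\<close>. If every tree of order exceeding \<open>\<mu>\<close> that grows above \<open>t\<close> contains a further
  acceptable block, then a tree of order exceeding \<open>\<mu> \<cdot> \<xi>\<close> yields a tree of blocks of order
  exceeding \<open>\<xi>\<close>: a node \<open>t\<close> of rank \<open>\<mu> \<cdot> (\<zeta> + 1) = \<mu> \<cdot> \<zeta> + \<mu>\<close> carries above it a tree of rank \<open>\<mu>\<close>
  whose nodes still have rank \<open>\<mu> \<cdot> \<zeta>\<close>, and the next block is taken from there.
\<close>

lemma derived_tree_iter_blocks:
  assumes ext: "\<And>t b S. R t b \<Longrightarrow> (\<And>s. s \<in> S \<Longrightarrow> t @ s \<in> T) \<Longrightarrow>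
      [] \<in> derived_tree_iter \<mu> S \<Longrightarrow> \<exists>s\<in>S. \<exists>z. R (t @ s) (b @ [z])"
    and B: "\<And>t b. R t b \<Longrightarrow> b \<in> B"
  shows "R t b \<Longrightarrow> t \<in> derived_tree_iter (\<mu> * \<xi>) T \<Longrightarrow> b \<in> derived_tree_iter \<xi> B"
proof (induction \<xi> arbitrary: t b rule: less_induct)
  case (less \<xi>)
  show ?case
    unfolding in_derived_tree_iter_iff[of b]
  proof (intro conjI allI impI)
    show "b \<in> B" using B less.prems by blast
    fix \<zeta> assume "\<zeta> < \<xi>"
    define S where "S = {s. t @ s \<in> derived_tree_iter (\<mu> * \<zeta>) T}"
    have "t \<in> derived_tree_iter (\<mu> * \<zeta> + \<mu>) T"
      using less.prems derived_tree_iter_antimono[OF ordinal_mult_add_le[OF \<open>\<zeta> < \<xi>\<close>]] by blast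
    then have "t @ [] \<in> derived_tree_iter \<mu> (derived_tree_iter (\<mu> * \<zeta>) T)"
      using derived_tree_iter_add by fastforce
    then have "[] \<in> derived_tree_iter \<mu> S" unfolding S_def by (rule derived_tree_iter_above)
    moreover have "t @ s \<in> T" if "s \<in> S" for s
      using that derived_tree_iter_subset unfolding S_def by blast
    ultimately obtain s z where "s \<in> S" "R (t @ s) (b @ [z])"
      using ext less.prems(1) by blast
    then have "b @ [z] \<in> derived_tree_iter \<zeta> B"
      using less.IH[OF \<open>\<zeta> < \<xi>\<close>] by (simp add: S_def)
    then show "\<exists>s\<in>derived_tree_iter \<zeta> B. strict_prefix b s"
      by (rule bexI[rotated]) (simp add: strict_prefix_def)
  qed
qed

lemma tree_order_le_OrdD:
  assumes "tree_order T \<le> Ord \<nu>"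
  shows "derived_tree_iter \<nu> T = {}"
proof -
  have ex: "\<exists>\<xi>. derived_tree_iter (\<xi> :: 'a ordinal) T = {}"
    using assms unfolding tree_order_def by (auto split: if_splits)
  then have "(LEAST \<xi>. derived_tree_iter \<xi> T = {}) \<le> \<nu>"
    using assms unfolding tree_order_def by simp
  then show ?thesis using LeastI_ex[OF ex] derived_tree_iter_antimono by blast
qed

lemma tree_order_le_OrdI: "derived_tree_iter \<nu> T = {} \<Longrightarrow> tree_order T \<le> Ord \<nu>"
  by (auto simp: tree_order_def intro: Least_le)

text \<open>
  The empty sequence survives to a limit stage if it survives to all earlier ones, so the order
  of a rooted tree is never a limit ordinal.
\<close>

lemma tree_order_less_limit:
  assumes "[] \<in> T" "limit_ordinal \<nu>" "tree_order T \<le> Ord \<nu>"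
  shows "\<exists>\<xi><\<nu>. derived_tree_iter \<xi> T = {}"
proof (rule ccontr)
  assume "\<not> ?thesis"
  then have "[] \<in> derived_tree_iter \<xi> T" if "\<xi> < \<nu>" for \<xi>
    using that assms(1) Nil_in_derived_tree_iter by blast
  then have "[] \<in> derived_tree_iter \<nu> T"
    by (auto simp: derived_tree_iter_def orec_limit[OF assms(2)])
  then show False using tree_order_le_OrdD[OF assms(3)] by blast
qed


section \<open>Norms of coefficient sequences\<close>

lemma sum_lessThan_add: "(\<Sum>i<n + m. f i) = (\<Sum>i<n. f i) + (\<Sum>i<m. f (n + i))"
  for n m :: nat and f :: "nat \<Rightarrow> 'b::comm_monoid_add"
  by (induction m) (simp_all add: add.assoc)

lemma enn2real_ge_one: "1 \<le> p \<Longrightarrow> p \<noteq> \<infinity> \<Longrightarrow> 1 \<le> enn2real p"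
  using enn2real_mono[of 1 p] by (simp add: less_top)

lemma lp_norm_nonneg: "0 \<le> lp_norm p n a"
  by (auto simp: lp_norm_def)

lemma lp_norm_powr:
  assumes "1 \<le> p" "p \<noteq> \<infinity>"
  shows "lp_norm p n a powr enn2real p = (\<Sum>i<n. norm (a i) powr enn2real p)"
  using enn2real_ge_one[OF assms] assms(2)
  by (simp add: lp_norm_def powr_powr sum_nonneg)

lemma lp_norm_infinity_add:
  "lp_norm \<infinity> (n + m) c = max (lp_norm \<infinity> n c) (lp_norm \<infinity> m (\<lambda>i. c (n + i)))"
proof -
  have "i \<in> (\<lambda>i. n + i) ` {..<m}" if "i < n + m" "\<not> i < n" for i
    using that by (intro image_eqI[of _ _ "i - n"]) auto
  then have "{..<n + m} = {..<n} \<union> (\<lambda>i. n + i) ` {..<m}" by fastforce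
  then have "insert 0 ((\<lambda>i. norm (c i)) ` {..<n + m}) =
      insert 0 ((\<lambda>i. norm (c i)) ` {..<n}) \<union> insert 0 ((\<lambda>i. norm (c (n + i))) ` {..<m})"
    by auto
  then show ?thesis by (simp only: lp_norm_def if_True simp_thms) (subst Max.union, auto)
qed

text \<open>
  The norm of a concatenation depends on the norms of the two pieces only; this is what makes
  \<open>\<ell>\<^sub>p\<close>-normalised blocks of an \<open>\<ell>\<^sub>p\<close> sequence an \<open>\<ell>\<^sub>p\<close> sequence again.
\<close>

lemma lp_norm_add_cong:
  assumes "1 \<le> p" and "lp_norm p n c = lp_norm p n' c'"
    and "lp_norm p m (\<lambda>i. c (n + i)) = lp_norm p m' (\<lambda>i. c' (n' + i))"
  shows "lp_norm p (n + m) c = lp_norm p (n' + m') c'"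
proof (cases "p = \<infinity>")
  case True
  then show ?thesis using assms by (simp only: lp_norm_infinity_add)
next
  case False
  have "(\<Sum>i<n + m. norm (c i) powr enn2real p) = (\<Sum>i<n' + m'. norm (c' i) powr enn2real p)"
    unfolding sum_lessThan_add using assms lp_norm_powr[OF assms(1) False] by metis
  then show ?thesis using False by (simp add: lp_norm_def)
qed

lemma lp_norm_scale: "1 \<le> p \<Longrightarrow> lp_norm p n (\<lambda>i. t * a i) = norm t * lp_norm p n a"
  for a :: "nat \<Rightarrow> 'k::real_normed_field"
proof (cases "p = \<infinity>")
  case True
  have "Max (insert 0 ((\<lambda>i. norm t * norm (a i)) ` {..<n}))
      = Max ((\<lambda>x. norm t * x) ` insert 0 ((\<lambda>i. norm (a i)) ` {..<n}))"
    by (simp add: image_image)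
  also have "\<dots> = norm t * Max (insert 0 ((\<lambda>i. norm (a i)) ` {..<n}))"
    by (rule mono_Max_commute[symmetric]) (auto simp: mono_def mult_left_mono)
  finally show ?thesis using True by (simp add: lp_norm_def norm_mult)
next
  case False
  moreover assume "1 \<le> p"
  ultimately show ?thesis
    using enn2real_ge_one[of p]
    by (simp add: lp_norm_def norm_mult powr_mult powr_powr sum_nonneg flip: sum_distrib_left)
qed

lemma lp_norm_zero: "lp_norm p n (\<lambda>i. 0) = 0"
  by (auto simp: lp_norm_def image_constant_conv)

lemma lp_norm_cong: "(\<And>i. i < n \<Longrightarrow> a i = b i) \<Longrightarrow> lp_norm p n a = lp_norm p n b"
proof -
  assume *: "\<And>i. i < n \<Longrightarrow> a i = b i"
  have "(\<lambda>i. norm (a i)) ` {..<n} = (\<lambda>i. norm (b i)) ` {..<n}"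
    by (rule image_cong) (simp_all add: *)
  moreover have "(\<Sum>i<n. norm (a i) powr enn2real p) = (\<Sum>i<n. norm (b i) powr enn2real p)"
    by (rule sum.cong) (simp_all add: *)
  ultimately show ?thesis by (simp only: lp_norm_def)
qed

lemma lp_norm_Suc_0: "1 \<le> p \<Longrightarrow> lp_norm p (Suc 0) a = norm (a 0)"
  using enn2real_ge_one[of p] by (auto simp: lp_norm_def lessThan_Suc powr_powr)

lemma lp_norm_unit:
  assumes "1 \<le> p" "j < n"
  shows "lp_norm p n (\<lambda>i. if i = j then 1 else (0 :: 'k::real_normed_field)) = 1"
proof -
  let ?a = "\<lambda>i. if i = j then 1 else (0 :: 'k)"
  have 1: "lp_norm p (j + Suc 0) ?a = lp_norm p (0 + Suc 0) (\<lambda>i. 1 :: 'k)"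
  proof (rule lp_norm_add_cong[OF assms(1)])
    have "lp_norm p j ?a = lp_norm p j (\<lambda>i. 0 :: 'k)" by (rule lp_norm_cong) simp
    also have "\<dots> = lp_norm p 0 (\<lambda>i. 0 :: 'k)" by (simp only: lp_norm_zero)
    also have "\<dots> = lp_norm p 0 (\<lambda>i. 1 :: 'k)" by (rule lp_norm_cong) simp
    finally show "lp_norm p j ?a = lp_norm p 0 (\<lambda>i. 1 :: 'k)" .
  qed (simp add: lp_norm_Suc_0 assms)
  have "lp_norm p ((j + Suc 0) + (n - Suc j)) ?a = lp_norm p ((j + Suc 0) + 0) ?a"
  proof (rule lp_norm_add_cong[OF assms(1) refl])
    have "lp_norm p (n - Suc j) (\<lambda>i. ?a (j + Suc 0 + i)) = lp_norm p (n - Suc j) (\<lambda>i. 0 :: 'k)"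
      by (rule lp_norm_cong) simp
    also have "\<dots> = lp_norm p 0 (\<lambda>i. 0 :: 'k)" by (simp only: lp_norm_zero)
    also have "\<dots> = lp_norm p 0 (\<lambda>i. ?a (j + Suc 0 + i))" by (rule lp_norm_cong) simp
    finally show "lp_norm p (n - Suc j) (\<lambda>i. ?a (j + Suc 0 + i)) =
        lp_norm p 0 (\<lambda>i. ?a (j + Suc 0 + i))" .
  qed
  then show ?thesis using 1 assms by (simp add: lp_norm_Suc_0)
qed

lemma norm_le_lp_norm:
  assumes "1 \<le> p" "i < n"
  shows "norm (a i) \<le> lp_norm p n a"
proof (cases "p = \<infinity>")
  case True
  then show ?thesis using assms by (auto simp: lp_norm_def intro!: Max_ge)
next
  case False
  have "norm (a i) powr enn2real p \<le> lp_norm p n a powr enn2real p"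
    unfolding lp_norm_powr[OF assms(1) False] using assms by (intro member_le_sum) auto
  then show ?thesis
    using enn2real_ge_one[OF assms(1) False] lp_norm_nonneg[of p n a]
    by (metis norm_ge_zero not_le powr_less_mono2 less_le_trans zero_less_one)
qed

lemma lp_norm_one: "lp_norm 1 n a = (\<Sum>i<n. norm (a i))"
  by (simp add: lp_norm_def sum_nonneg)

text \<open>
  Errors \<open>\<delta>\<^sub>j\<close> attached to the members of an \<open>\<ell>\<^sub>p\<close> sequence must add up. In general they have to
  decay, but for \<open>p = 1\<close> they may be constant. With decaying errors one needs a common bound for
  the orders at infinitely many constants, with constant errors one constant at a time suffices.
\<close>

lemma lp_summable_weights:
  assumes "1 \<le> p" "0 < \<epsilon>"
  obtains \<delta> :: "nat \<Rightarrow> real" where "\<And>j. 0 < \<delta> j" and "p = 1 \<Longrightarrow> \<delta> = (\<lambda>j. \<epsilon>)"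
    and "\<And>n (a :: nat \<Rightarrow> 'k::real_normed_field). lp_norm p n a = 1 \<Longrightarrow>
      (\<Sum>j<n. norm (a j) * \<delta> j) \<le> \<epsilon>"
proof (cases "p = 1")
  case True
  show thesis
    by (rule that[of "\<lambda>j. \<epsilon>"]) (use True assms in \<open>auto simp: lp_norm_one simp flip: sum_distrib_right\<close>)
next
  case False
  show thesis
  proof (rule that[of "\<lambda>j. \<epsilon> * (1/2) ^ Suc j"])
    fix n and a :: "nat \<Rightarrow> 'k" assume a: "lp_norm p n a = 1"
    have "(\<Sum>j<n. norm (a j) * (\<epsilon> * (1/2) ^ Suc j)) \<le> (\<Sum>j<n. 1 * (\<epsilon> * (1/2) ^ Suc j))"
      using norm_le_lp_norm[OF assms(1), of _ n a] a assms(2)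
      by (intro sum_mono mult_right_mono) auto
    also have "\<dots> = \<epsilon> * (1 - (1/2) ^ n)"
      by (induction n) (simp_all add: field_simps)
    also have "\<dots> \<le> \<epsilon>" using assms(2) by simp
    finally show "(\<Sum>j<n. norm (a j) * (\<epsilon> * (1/2) ^ Suc j)) \<le> \<epsilon>" .
  qed (use False assms in auto)
qed


section \<open>Linear combinations and blocks\<close>

definition comb :: "('k, 'v::ab_group_add) nspace \<Rightarrow> (nat \<Rightarrow> 'k) \<Rightarrow> 'v list \<Rightarrow> 'v" where
  "comb X a xs = (\<Sum>i<length xs. smult X (a i) (xs ! i))"

lemma in_T_tree_iff:
  "xs \<in> T_tree p X K \<longleftrightarrow> (\<forall>x\<in>set xs. x \<in> vecs X \<and> nrm X x \<le> 1) \<and>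
     (\<forall>a. lp_norm p (length xs) a = 1 \<longrightarrow>
        inverse K \<le> nrm X (comb X a xs) \<and> nrm X (comb X a xs) \<le> 1)"
  by (simp add: T_tree_def comb_def)

lemma Nil_in_T_tree: "[] \<in> T_tree p X K"
  by (auto simp: in_T_tree_iff lp_norm_def)

text \<open>
  The multiplication of a direct sum, as a function on all families, is a vector space structure
  only up to \<open>1 x = x\<close>, which fails for families that do not vanish outside the index set.
\<close>

locale scaled_space =
  fixes X :: "('k::real_normed_field, 'v::ab_group_add) nspace"
  assumes smult_add: "smult X c (x + y) = smult X c x + smult X c y"
    and smult_smult: "smult X c (smult X d x) = smult X (c * d) x"
    and smult_zero_left: "smult X 0 x = 0"
    and smult_one: "x \<in> vecs X \<Longrightarrow> smult X 1 x = x"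
    and zero_in: "0 \<in> vecs X"
    and add_in: "x \<in> vecs X \<Longrightarrow> y \<in> vecs X \<Longrightarrow> x + y \<in> vecs X"
    and smult_in: "x \<in> vecs X \<Longrightarrow> smult X c x \<in> vecs X"
begin

lemma smult_zero_right: "smult X c 0 = 0"
  using smult_add[of c 0 0] by simp

lemma smult_sum: "smult X c (\<Sum>i\<in>I. f i) = (\<Sum>i\<in>I. smult X c (f i))"
  by (induction I rule: infinite_finite_induct) (simp_all add: smult_add smult_zero_right)

lemma sum_in: "(\<And>i. i \<in> I \<Longrightarrow> f i \<in> vecs X) \<Longrightarrow> (\<Sum>i\<in>I. f i) \<in> vecs X"
  by (induction I rule: infinite_finite_induct) (simp_all add: add_in zero_in)

lemma comb_in: "set xs \<subseteq> vecs X \<Longrightarrow> comb X a xs \<in> vecs X"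
  unfolding comb_def by (intro sum_in smult_in) auto

lemma comb_append: "comb X a (xs @ ys) = comb X a xs + comb X (\<lambda>i. a (length xs + i)) ys"
  by (simp add: comb_def sum_lessThan_add nth_append)

lemma comb_singleton: "comb X a [x] = smult X (a 0) x"
  by (simp add: comb_def)

lemma comb_scale: "comb X (\<lambda>i. c * a i) xs = smult X c (comb X a xs)"
  by (simp add: comb_def smult_sum smult_smult)

lemma comb_zero: "comb X (\<lambda>i. 0) xs = 0"
  by (simp add: comb_def smult_zero_left)

lemma comb_cong: "(\<And>i. i < length xs \<Longrightarrow> a i = b i) \<Longrightarrow> comb X a xs = comb X b xs"
  by (simp add: comb_def)

lemma comb_unit:
  assumes "j < length xs" "xs ! j \<in> vecs X"
  shows "comb X (\<lambda>i. if i = j then 1 else 0) xs = xs ! j"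
proof -
  have "comb X (\<lambda>i. if i = j then 1 else 0) xs = (\<Sum>i<length xs. if i = j then xs ! j else 0)"
    unfolding comb_def using assms by (intro sum.cong) (auto simp: smult_one smult_zero_left)
  then show ?thesis using assms by simp
qed

lemma T_treeI:
  assumes "1 \<le> p" "set xs \<subseteq> vecs X"
    and "\<And>a. lp_norm p (length xs) a = 1 \<Longrightarrow>
      inverse K \<le> nrm X (comb X a xs) \<and> nrm X (comb X a xs) \<le> 1"
  shows "xs \<in> T_tree p X K"
  unfolding in_T_tree_iff
proof (intro conjI ballI)
  fix x assume x: "x \<in> set xs"
  then obtain j where "j < length xs" "xs ! j = x" by (auto simp: in_set_conv_nth)
  then show "nrm X x \<le> 1"
    using assms(3)[OF lp_norm_unit[OF assms(1)]] comb_unit[of j xs] x assms(2) by fastforce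
qed (use assms in auto)

lemma T_tree_append:
  assumes "1 \<le> p" "t @ s \<in> T_tree p X K"
  shows "s \<in> T_tree p X K"
proof (rule T_treeI[OF assms(1)])
  show "set s \<subseteq> vecs X" using assms by (auto simp: in_T_tree_iff)
  fix a :: "nat \<Rightarrow> 'k" assume a: "lp_norm p (length s) a = 1"
  define c where "c i = (if i < length t then 0 else a (i - length t))" for i
  have "comb X c (t @ s) = comb X a s"
    by (simp add: comb_append c_def comb_cong[of t _ "\<lambda>i. 0"] comb_zero)
  moreover have "lp_norm p (length t + length s) c = lp_norm p (0 + length s) a"
  proof (rule lp_norm_add_cong[OF assms(1)])
    show "lp_norm p (length t) c = lp_norm p 0 a"
      by (simp add: lp_norm_zero c_def lp_norm_cong[of "length t" _ "\<lambda>i. 0"]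
          lp_norm_cong[of 0 a "\<lambda>i. 0"])
  qed (simp add: c_def)
  ultimately show "inverse K \<le> nrm X (comb X a s) \<and> nrm X (comb X a s) \<le> 1"
    using assms(2) a by (auto simp: in_T_tree_iff)
qed

end

inductive blocking :: "ennreal \<Rightarrow> ('k::real_normed_field, 'v::ab_group_add) nspace \<Rightarrow>
    'v list \<Rightarrow> 'v list \<Rightarrow> bool" for p X where
  Nil: "blocking p X [] []"
| snoc: "blocking p X s b \<Longrightarrow> lp_norm p (length r) a = 1 \<Longrightarrow>
    blocking p X (s @ r) (b @ [comb X a r])"

context scaled_space
begin

lemma blocking_comb:
  assumes "1 \<le> p" "blocking p X s b"
  shows "\<exists>c. lp_norm p (length s) c = lp_norm p (length b) a \<and> comb X c s = comb X a b"
  using assms(2)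
proof (induction rule: blocking.induct)
  case Nil
  then show ?case by auto
next
  case (snoc s b r d)
  then obtain c where c: "lp_norm p (length s) c = lp_norm p (length b) a"
    "comb X c s = comb X a b" by blast
  define c' where "c' i = (if i < length s then c i else a (length b) * d (i - length s))" for i
  have "lp_norm p (length s + length r) c' = lp_norm p (length b + Suc 0) a"
  proof (rule lp_norm_add_cong[OF assms(1)])
    have "lp_norm p (length s) c' = lp_norm p (length s) c"
      by (rule lp_norm_cong) (simp add: c'_def)
    then show "lp_norm p (length s) c' = lp_norm p (length b) a" using c(1) by simp
    show "lp_norm p (length r) (\<lambda>i. c' (length s + i)) = lp_norm p (Suc 0) (\<lambda>i. a (length b + i))"
      by (simp add: c'_def lp_norm_scale lp_norm_Suc_0 assms(1) snoc(2))
  qed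
  moreover have "comb X c' s = comb X c s"
    by (rule comb_cong) (simp add: c'_def)
  then have "comb X c' (s @ r) = comb X a (b @ [comb X d r])"
    by (simp add: comb_append comb_singleton c'_def comb_scale c(2))
  ultimately show ?case by (intro exI[of _ c']) simp
qed

lemma blocking_in_vecs:
  assumes "blocking p X s b" "set s \<subseteq> vecs X"
  shows "set b \<subseteq> vecs X"
  using assms
proof (induction rule: blocking.induct)
  case (snoc s b r a)
  then show ?case using comb_in[of r a] by simp
qed simp

lemma blocking_T_tree:
  assumes "1 \<le> p" "blocking p X s b" "s \<in> T_tree p X K"
  shows "b \<in> T_tree p X K"
proof (rule T_treeI[OF assms(1)])
  show "set b \<subseteq> vecs X"
    using blocking_in_vecs[OF assms(2)] assms(3) by (auto simp: in_T_tree_iff)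
  fix a :: "nat \<Rightarrow> 'k" assume "lp_norm p (length b) a = 1"
  then show "inverse K \<le> nrm X (comb X a b) \<and> nrm X (comb X a b) \<le> 1"
    using blocking_comb[OF assms(1,2), of a] assms(3) unfolding in_T_tree_iff by metis
qed

end

lemma banach_space_scaled_space:
  assumes "banach_space X"
  shows "scaled_space X"
proof -
  interpret V: vector_space "smult X" using assms by (simp add: banach_space_def)
  have S: "V.subspace (vecs X)" using assms by (simp add: banach_space_def)
  show ?thesis
    by unfold_locales (auto simp: V.scale_right_distrib V.subspace_0[OF S]
        intro: V.subspace_add[OF S] V.subspace_scale[OF S])
qed

section \<open>Direct sums over an unconditional basis\<close>

locale banach =
  fixes X :: "('k::{real_normed_field, euclidean_space}, 'v::ab_group_add) nspace"
  assumes banach: "banach_space X"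
begin

sublocale vector_space "smult X"
  using banach by (simp add: banach_space_def)

sublocale scaled_space X
  using banach by (rule banach_space_scaled_space)

lemma nrm_nonneg: "x \<in> vecs X \<Longrightarrow> 0 \<le> nrm X x"
  using banach by (simp add: banach_space_def)

lemma nrm_eq_0: "x \<in> vecs X \<Longrightarrow> nrm X x = 0 \<longleftrightarrow> x = 0"
  using banach by (simp add: banach_space_def)

lemma nrm_zero: "nrm X 0 = 0"
  using nrm_eq_0[OF zero_in] by simp

lemma nrm_smult: "x \<in> vecs X \<Longrightarrow> nrm X (smult X c x) = norm c * nrm X x"
  using banach by (simp add: banach_space_def)

lemma nrm_triangle: "x \<in> vecs X \<Longrightarrow> y \<in> vecs X \<Longrightarrow> nrm X (x + y) \<le> nrm X x + nrm X y"
  using banach by (simp add: banach_space_def)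

lemma Cauchy_converges:
  fixes f :: "nat \<Rightarrow> 'v"
  assumes "range f \<subseteq> vecs X"
    and "\<And>\<epsilon>. 0 < \<epsilon> \<Longrightarrow> \<exists>N. \<forall>m\<ge>N. \<forall>n\<ge>N. nrm X (f m - f n) < \<epsilon>"
  obtains x where "x \<in> vecs X" "(\<lambda>n. nrm X (f n - x)) \<longlonglongrightarrow> 0"
proof -
  have "\<forall>f :: nat \<Rightarrow> 'v. range f \<subseteq> vecs X \<longrightarrow>
      (\<forall>\<epsilon>>0. \<exists>N. \<forall>m\<ge>N. \<forall>n\<ge>N. nrm X (f m - f n) < \<epsilon>) \<longrightarrow>
      (\<exists>x\<in>vecs X. (\<lambda>n. nrm X (f n - x)) \<longlonglongrightarrow> 0)"
    using banach unfolding banach_space_def by (elim conjE)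
  then have "\<exists>x\<in>vecs X. (\<lambda>n. nrm X (f n - x)) \<longlonglongrightarrow> 0" using assms by simp
  then show thesis using that by auto
qed

lemma minus_in: "x \<in> vecs X \<Longrightarrow> y \<in> vecs X \<Longrightarrow> x - y \<in> vecs X"
  using add_in[of x "smult X (- 1) y"] smult_in[of y "- 1"] by simp

lemma nrm_minus_commute: "x \<in> vecs X \<Longrightarrow> y \<in> vecs X \<Longrightarrow> nrm X (x - y) = nrm X (y - x)"
  using nrm_smult[OF minus_in, of x y "- 1"] by simp

lemma nrm_triangle_diff: "x \<in> vecs X \<Longrightarrow> y \<in> vecs X \<Longrightarrow> nrm X (x - y) \<le> nrm X x + nrm X y"
  using nrm_triangle[OF _ minus_in[OF zero_in], of x y] nrm_minus_commute[OF zero_in, of y] by simp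

lemma nrm_sum_le:
  assumes "finite I" "\<And>i. i \<in> I \<Longrightarrow> v i \<in> vecs X"
  shows "nrm X (\<Sum>i\<in>I. smult X (a i) (v i)) \<le> (\<Sum>i\<in>I. norm (a i) * nrm X (v i))"
  using assms
proof (induction I)
  case (insert i I)
  have "nrm X (smult X (a i) (v i) + (\<Sum>i\<in>I. smult X (a i) (v i)))
      \<le> nrm X (smult X (a i) (v i)) + nrm X (\<Sum>i\<in>I. smult X (a i) (v i))"
    using insert by (intro nrm_triangle sum_in smult_in) auto
  also have "\<dots> \<le> norm (a i) * nrm X (v i) + (\<Sum>i\<in>I. norm (a i) * nrm X (v i))"
    using insert by (intro add_mono) (auto simp: nrm_smult)
  finally show ?case using insert by simp
qed (simp add: nrm_zero)

lemma nrm_diff_le: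
  assumes "x \<in> vecs X" "y \<in> vecs X"
  shows "\<bar>nrm X x - nrm X y\<bar> \<le> nrm X (x - y)"
  using nrm_triangle[OF minus_in[OF assms] assms(2)] nrm_triangle[OF minus_in[OF assms(2,1)] assms(1)]
    nrm_minus_commute[OF assms] by simp

end

lemma sum_fun_apply: "(\<Sum>i\<in>I. f i) e = (\<Sum>i\<in>I. f i e)"
  for f :: "'i \<Rightarrow> 'u \<Rightarrow> 'x::comm_monoid_add"
  by (induction I rule: infinite_finite_induct) simp_all

locale unconditional_sum = U: banach U
  for U :: "('k::{real_normed_field, euclidean_space}, 'u::ab_group_add) nspace" +
  fixes E :: "'u set" and X :: "'u \<Rightarrow> ('k, 'x::ab_group_add) nspace"
  assumes basis: "one_unconditional_basis U E"
    and summands: "\<And>e. e \<in> E \<Longrightarrow> banach (X e)"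
begin

abbreviation "XE \<equiv> direct_sum U E X"

definition psum :: "'u set \<Rightarrow> ('u \<Rightarrow> 'k) \<Rightarrow> 'u" where
  "psum F a = (\<Sum>e\<in>F. smult U (a e) e)"

definition pnorm :: "'u set \<Rightarrow> ('u \<Rightarrow> 'k) \<Rightarrow> real" where
  "pnorm F a = nrm U (psum F a)"

lemma basis_in: "e \<in> E \<Longrightarrow> e \<in> vecs U"
  using basis by (auto simp: one_unconditional_basis_def)

lemma psum_in: "F \<subseteq> E \<Longrightarrow> psum F a \<in> vecs U"
  unfolding psum_def by (intro U.sum_in U.smult_in basis_in) auto

lemma pnorm_nonneg: "F \<subseteq> E \<Longrightarrow> 0 \<le> pnorm F a"
  unfolding pnorm_def by (intro U.nrm_nonneg psum_in)

lemma psum_add: "psum F (\<lambda>e. a e + b e) = psum F a + psum F b"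
  by (simp add: psum_def U.scale_left_distrib sum.distrib)

lemma psum_scale: "psum F (\<lambda>e. c * a e) = smult U c (psum F a)"
  by (simp add: psum_def U.scale_sum_right)

lemma pnorm_add: "F \<subseteq> E \<Longrightarrow> pnorm F (\<lambda>e. a e + b e) \<le> pnorm F a + pnorm F b"
  unfolding pnorm_def psum_add by (intro U.nrm_triangle psum_in)

lemma pnorm_scale: "F \<subseteq> E \<Longrightarrow> pnorm F (\<lambda>e. c * a e) = norm c * pnorm F a"
  unfolding pnorm_def psum_scale by (intro U.nrm_smult psum_in)

lemma psum_cong: "(\<And>e. e \<in> F \<Longrightarrow> a e = b e) \<Longrightarrow> psum F a = psum F b"
  by (simp add: psum_def)

lemma psum_Un: "finite F \<Longrightarrow> finite G \<Longrightarrow> F \<inter> G = {} \<Longrightarrow> psum (F \<union> G) a = psum F a + psum G a"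
  unfolding psum_def by (rule sum.union_disjoint)

lemma pnorm_unimodular:
  assumes "finite F" "F \<subseteq> E" "\<And>e. e \<in> F \<Longrightarrow> norm (a e) = norm (b e)"
  shows "pnorm F a = pnorm F b"
proof -
  have zero: "a e = 0 \<longleftrightarrow> b e = 0" if "e \<in> F" for e
    using assms(3)[OF that] by (metis norm_eq_zero)
  define \<theta> where "\<theta> e = (if a e = 0 then 1 else b e / a e)" for e
  have "\<forall>e\<in>F. norm (\<theta> e) = 1"
    using assms(3) zero by (simp add: \<theta>_def norm_divide)
  then have "pnorm F (\<lambda>e. \<theta> e * a e) = pnorm F a"
    using basis assms(1,2) unfolding one_unconditional_basis_def pnorm_def psum_def by blast
  moreover have "psum F (\<lambda>e. \<theta> e * a e) = psum F b"
    by (intro psum_cong) (simp add: \<theta>_def zero)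
  ultimately show ?thesis by (simp add: pnorm_def)
qed

text \<open>
  Shrinking one coefficient is an average of keeping it and of changing its sign, up to a
  unimodular factor; hence it does not increase the norm.
\<close>

lemma pnorm_shrink:
  assumes "finite F" "F \<subseteq> E" and y: "norm y \<le> norm (f g)"
  shows "pnorm F (f(g := y)) \<le> pnorm F f"
proof (cases "f g = 0")
  case True
  then have "f(g := y) = f" using y by auto
  then show ?thesis by simp
next
  case False
  define t where "t = norm y / norm (f g)"
  have t: "0 \<le> t" "t \<le> 1" using y False by (auto simp: t_def divide_le_eq_1)
  define r s where "r = (1 + t) / 2" and "s = (1 - t) / 2"
  have rs: "0 \<le> r" "0 \<le> s" "r + s = 1" "r - s = t" using t by (auto simp: r_def s_def field_simps)
  let ?f' = "f(g := - f g)"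
  have "pnorm F (f(g := y)) = pnorm F (\<lambda>e. of_real r * f e + of_real s * ?f' e)"
  proof (rule pnorm_unimodular[OF assms(1,2)])
    fix e
    have "of_real r * f e + of_real s * f e = f e"
      using rs(3) by (metis distrib_right mult_1 of_real_1 of_real_add)
    moreover have "of_real r * f g - of_real s * f g = of_real t * f g"
      using rs(4) by (metis left_diff_distrib of_real_diff)
    moreover have "norm (of_real t * f g) = t * norm (f g)" using t by (simp add: norm_mult)
    moreover have "t * norm (f g) = norm y" using False by (simp add: t_def)
    ultimately show "norm ((f(g := y)) e) = norm (of_real r * f e + of_real s * ?f' e)" by simp
  qed
  also have "\<dots> \<le> r * pnorm F f + s * pnorm F ?f'"
    using pnorm_add[OF assms(2), of "\<lambda>e. of_real r * f e" "\<lambda>e. of_real s * ?f' e"] rs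
    by (simp add: pnorm_scale[OF assms(2)] del: fun_upd_apply)
  also have "pnorm F ?f' = pnorm F f"
    by (rule pnorm_unimodular[OF assms(1,2)]) simp
  also have "r * pnorm F f + s * pnorm F f = pnorm F f"
    using rs(3) by (metis distrib_right mult_1)
  finally show ?thesis .
qed

lemma pnorm_mono:
  assumes "finite F" "F \<subseteq> E" and le: "\<And>e. e \<in> F \<Longrightarrow> norm (b e) \<le> norm (a e)"
  shows "pnorm F b \<le> pnorm F a"
proof -
  have "pnorm F (\<lambda>e. if e \<in> G then b e else a e) \<le> pnorm F a" if "G \<subseteq> F" for G
    using finite_subset[OF that assms(1)] that
  proof (induction G)
    case (insert g G)
    let ?f = "\<lambda>e. if e \<in> G then b e else a e"
    have "(\<lambda>e. if e \<in> insert g G then b e else a e) = ?f(g := b g)" by auto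
    moreover have "pnorm F (?f(g := b g)) \<le> pnorm F ?f"
      using insert le by (intro pnorm_shrink assms) auto
    ultimately show ?case using insert by simp
  qed simp
  from this[of F] show ?thesis
    using psum_cong[of F "\<lambda>e. if e \<in> F then b e else a e" b] by (simp add: pnorm_def)
qed

lemma pnorm_extend:
  assumes "finite F" "F \<subseteq> E" "G \<subseteq> F" and "\<And>e. e \<in> F - G \<Longrightarrow> a e = 0"
  shows "pnorm F a = pnorm G a"
  unfolding pnorm_def psum_def
  by (rule arg_cong[of _ _ "nrm U"], rule sum.mono_neutral_right) (use assms in auto)

lemma pnorm_mono_set:
  assumes "finite F" "F \<subseteq> E" "G \<subseteq> F"
  shows "pnorm G a \<le> pnorm F a"
proof -
  have "pnorm G a = pnorm G (\<lambda>e. if e \<in> G then a e else 0)"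
    unfolding pnorm_def by (rule arg_cong[OF psum_cong]) simp
  also have "\<dots> = pnorm F (\<lambda>e. if e \<in> G then a e else 0)"
    using assms by (intro pnorm_extend[symmetric]) auto
  also have "\<dots> \<le> pnorm F a" using assms by (intro pnorm_mono) auto
  finally show ?thesis .
qed

lemma sums_to_psum: "sums_to U E a u \<longleftrightarrow>
    ((\<lambda>F. nrm U (psum F a - u)) \<longlongrightarrow> 0) (finite_subsets_at_top E)"
  by (simp add: sums_to_def psum_def)

lemma eventually_subset: "\<forall>\<^sub>F F in finite_subsets_at_top E. finite F \<and> F \<subseteq> E"
  by (auto simp: eventually_finite_subsets_at_top)

lemma pnorm_tendsto:
  assumes "u \<in> vecs U" "sums_to U E a u"
  shows "((\<lambda>F. pnorm F a) \<longlongrightarrow> nrm U u) (finite_subsets_at_top E)"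
proof (rule LIM_zero_cancel, rule Lim_null_comparison)
  show "\<forall>\<^sub>F F in finite_subsets_at_top E. norm (pnorm F a - nrm U u) \<le> nrm U (psum F a - u)"
    using eventually_subset
    by eventually_elim (use U.nrm_diff_le psum_in assms in \<open>auto simp: pnorm_def\<close>)
qed (use assms in \<open>simp add: sums_to_psum\<close>)

text \<open>
  The finite partial sums increase in norm, so the norm of an infinite sum is their supremum;
  the norm estimates in the direct sum are reduced to finite sums in this way.
\<close>

lemma pnorm_le_nrm:
  assumes "u \<in> vecs U" "sums_to U E a u" "finite F" "F \<subseteq> E"
  shows "pnorm F a \<le> nrm U u"
proof (rule tendsto_lowerbound[OF pnorm_tendsto[OF assms(1,2)]])
  show "\<forall>\<^sub>F G in finite_subsets_at_top E. pnorm F a \<le> pnorm G a"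
    using assms(3,4) pnorm_mono_set by (auto simp: eventually_finite_subsets_at_top)
qed simp

lemma nrm_le_pnorm:
  assumes "u \<in> vecs U" "sums_to U E a u"
    and "\<And>F. finite F \<Longrightarrow> F \<subseteq> E \<Longrightarrow> pnorm F a \<le> M"
  shows "nrm U u \<le> M"
proof (rule tendsto_upperbound[OF pnorm_tendsto[OF assms(1,2)]])
  show "\<forall>\<^sub>F F in finite_subsets_at_top E. pnorm F a \<le> M"
    using eventually_subset by eventually_elim (use assms in auto)
qed simp

lemma sums_to_unique:
  assumes "u \<in> vecs U" "sums_to U E a u" "v \<in> vecs U" "sums_to U E a v"
  shows "u = v"
proof -
  have "((\<lambda>F. nrm U (psum F a - v) + nrm U (psum F a - u)) \<longlongrightarrow> 0 + 0) (finite_subsets_at_top E)"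
    using assms unfolding sums_to_psum by (intro tendsto_add) auto
  moreover have "\<forall>\<^sub>F F in finite_subsets_at_top E.
      nrm U (u - v) \<le> nrm U (psum F a - v) + nrm U (psum F a - u)"
    using eventually_subset
  proof eventually_elim
    case (elim F)
    then show ?case
      using U.nrm_triangle_diff[of "psum F a - v" "psum F a - u"] assms psum_in[of F a]
      by (simp add: U.minus_in)
  qed
  ultimately have "nrm U (u - v) \<le> 0"
    using tendsto_lowerbound[of _ 0 "finite_subsets_at_top E" "nrm U (u - v)"] by simp
  then show ?thesis
    using U.nrm_eq_0[OF U.minus_in[OF assms(1,3)]] U.nrm_nonneg[OF U.minus_in[OF assms(1,3)]] by simp
qed

text \<open>
  By completeness, convergence amounts to small tails. Together with monotonicity of the
  norm in the moduli of the coefficients this makes the direct sum closed under addition.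
\<close>

lemma summable_Cauchy:
  "(\<exists>u\<in>vecs U. sums_to U E a u) \<longleftrightarrow>
    (\<forall>\<epsilon>>0. \<exists>F. finite F \<and> F \<subseteq> E \<and> (\<forall>G. finite G \<longrightarrow> G \<subseteq> E - F \<longrightarrow> pnorm G a < \<epsilon>))"
proof (intro iffI allI impI)
  fix \<epsilon> :: real assume "\<epsilon> > 0" "\<exists>u\<in>vecs U. sums_to U E a u"
  then obtain u where u: "u \<in> vecs U" "sums_to U E a u" by blast
  have "\<forall>\<^sub>F F in finite_subsets_at_top E. nrm U (psum F a - u) < \<epsilon> / 2"
    using u(2) \<open>\<epsilon> > 0\<close> unfolding sums_to_psum by (intro order_tendstoD) auto
  then obtain F where F: "finite F" "F \<subseteq> E"
    "\<And>G. finite G \<Longrightarrow> F \<subseteq> G \<Longrightarrow> G \<subseteq> E \<Longrightarrow> nrm U (psum G a - u) < \<epsilon> / 2"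
    by (auto simp: eventually_finite_subsets_at_top)
  have "pnorm G a < \<epsilon>" if G: "finite G" "G \<subseteq> E - F" for G
  proof -
    have FG: "psum (F \<union> G) a = psum F a + psum G a" using G F by (intro psum_Un) auto
    have "nrm U (psum (F \<union> G) a - u) < \<epsilon> / 2" "nrm U (psum F a - u) < \<epsilon> / 2"
      using F(1,2) G by (auto intro!: F(3) simp del: less_divide_eq_numeral1)
    moreover have "nrm U ((psum (F \<union> G) a - u) - (psum F a - u))
        \<le> nrm U (psum (F \<union> G) a - u) + nrm U (psum F a - u)"
      using F G u by (intro U.nrm_triangle_diff U.minus_in psum_in) auto
    ultimately show ?thesis by (simp add: FG pnorm_def)
  qed
  then show "\<exists>F. finite F \<and> F \<subseteq> E \<and> (\<forall>G. finite G \<longrightarrow> G \<subseteq> E - F \<longrightarrow> pnorm G a < \<epsilon>)"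
    using F by blast
next
  assume *: "\<forall>\<epsilon>>0. \<exists>F. finite F \<and> F \<subseteq> E \<and> (\<forall>G. finite G \<longrightarrow> G \<subseteq> E - F \<longrightarrow> pnorm G a < \<epsilon>)"
  have "\<exists>F. finite F \<and> F \<subseteq> E \<and> (\<forall>G. finite G \<longrightarrow> G \<subseteq> E - F \<longrightarrow> pnorm G a < inverse (Suc n))"
    for n using *[rule_format, of "inverse (Suc n)"] by simp
  then obtain F where F: "\<And>n. finite (F n)" "\<And>n. F n \<subseteq> E"
    "\<And>n G. finite G \<Longrightarrow> G \<subseteq> E - F n \<Longrightarrow> pnorm G a < inverse (Suc n)" by metis
  define H where "H n = (\<Union>k\<le>n. F k)" for n
  have H: "finite (H n)" "H n \<subseteq> E" for n using F by (auto simp: H_def)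
  have tail: "nrm U (psum G a - psum (H n) a) < inverse (Suc n)"
    if "finite G" "H n \<subseteq> G" "G \<subseteq> E" for G n
  proof -
    have "psum G a = psum (H n \<union> (G - H n)) a"
      using that by (simp add: Un_absorb1)
    also have "\<dots> = psum (H n) a + psum (G - H n) a"
      by (rule psum_Un) (use that H in auto)
    finally have "nrm U (psum G a - psum (H n) a) = pnorm (G - H n) a"
      by (simp add: pnorm_def)
    also have "\<dots> < inverse (Suc n)" using that by (intro F) (auto simp: H_def)
    finally show ?thesis .
  qed
  obtain u where u: "u \<in> vecs U" "(\<lambda>n. nrm U (psum (H n) a - u)) \<longlonglongrightarrow> 0"
  proof (rule U.Cauchy_converges[of "\<lambda>n. psum (H n) a"])
    show "range (\<lambda>n. psum (H n) a) \<subseteq> vecs U" using psum_in H by auto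
    fix \<epsilon> :: real assume "\<epsilon> > 0"
    then obtain N where N: "inverse (Suc N) < \<epsilon> / 2"
      using reals_Archimedean[of "\<epsilon> / 2"] by auto
    have "nrm U (psum (H m) a - psum (H n) a) < \<epsilon>" if "N \<le> m" "N \<le> n" for m n
    proof -
      have sub: "H N \<subseteq> H m" "H N \<subseteq> H n" using that by (force simp: H_def)+
      have "nrm U ((psum (H m) a - psum (H N) a) - (psum (H n) a - psum (H N) a))
          \<le> nrm U (psum (H m) a - psum (H N) a) + nrm U (psum (H n) a - psum (H N) a)"
        using H by (intro U.nrm_triangle_diff U.minus_in psum_in)
      then show ?thesis using tail[OF H(1) sub(1) H(2)] tail[OF H(1) sub(2) H(2)] N by simp
    qed
    then show "\<exists>N. \<forall>m\<ge>N. \<forall>n\<ge>N. nrm U (psum (H m) a - psum (H n) a) < \<epsilon>" by blast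
  qed
  have "sums_to U E a u"
    unfolding sums_to_psum
  proof (rule tendstoI)
    fix \<epsilon> :: real assume "\<epsilon> > 0"
    then obtain N where N: "inverse (Suc N) < \<epsilon> / 2"
      using reals_Archimedean[of "\<epsilon> / 2"] by auto
    have "\<forall>\<^sub>F n in sequentially. nrm U (psum (H n) a - u) < \<epsilon> / 2"
      using u(2) \<open>\<epsilon> > 0\<close> by (intro order_tendstoD) auto
    then obtain M where "\<And>n. M \<le> n \<Longrightarrow> nrm U (psum (H n) a - u) < \<epsilon> / 2"
      by (auto simp only: eventually_sequentially)
    then obtain n where n: "N \<le> n" "nrm U (psum (H n) a - u) < \<epsilon> / 2"
      using max.cobounded1 max.cobounded2 by metis
    have "dist (nrm U (psum G a - u)) 0 < \<epsilon>" if G: "finite G" "H n \<subseteq> G" "G \<subseteq> E" for G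
    proof -
      have "nrm U ((psum G a - psum (H n) a) + (psum (H n) a - u))
          \<le> nrm U (psum G a - psum (H n) a) + nrm U (psum (H n) a - u)"
        using H u G by (intro U.nrm_triangle U.minus_in psum_in)
      moreover have "inverse (real (Suc n)) < \<epsilon> / 2"
        by (rule le_less_trans[OF _ N]) (use n in simp)
      ultimately have "nrm U (psum G a - u) < \<epsilon>" using tail[OF G] n by simp
      then show ?thesis using U.nrm_nonneg[OF U.minus_in[OF psum_in u(1)], of G a] G by simp
    qed
    then show "\<forall>\<^sub>F F in finite_subsets_at_top E. dist (nrm U (psum F a - u)) 0 < \<epsilon>"
      using H[of n] unfolding eventually_finite_subsets_at_top by blast
  qed
  then show "\<exists>u\<in>vecs U. sums_to U E a u" using u by blast
qed

definition moduli :: "('u \<Rightarrow> 'x) \<Rightarrow> 'u \<Rightarrow> 'k" where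
  "moduli x e = of_real (nrm (X e) (x e))"

lemma norm_moduli: "e \<in> E \<Longrightarrow> x e \<in> vecs (X e) \<Longrightarrow> norm (moduli x e) = nrm (X e) (x e)"
  using banach.nrm_nonneg[OF summands] by (simp add: moduli_def)

lemma in_vecs_iff:
  "x \<in> vecs XE \<longleftrightarrow> (\<forall>e\<in>E. x e \<in> vecs (X e)) \<and> (\<forall>e. e \<notin> E \<longrightarrow> x e = 0) \<and>
     (\<forall>\<epsilon>>0. \<exists>F. finite F \<and> F \<subseteq> E \<and>
        (\<forall>G. finite G \<longrightarrow> G \<subseteq> E - F \<longrightarrow> pnorm G (moduli x) < \<epsilon>))"
  unfolding summable_Cauchy[symmetric] by (simp add: direct_sum_def moduli_def[abs_def])

lemma coord_in: "x \<in> vecs XE \<Longrightarrow> e \<in> E \<Longrightarrow> x e \<in> vecs (X e)"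
  by (simp add: in_vecs_iff)

lemma nrm_XE:
  assumes "x \<in> vecs XE"
  obtains u where "u \<in> vecs U" "sums_to U E (moduli x) u" "nrm XE x = nrm U u"
proof -
  obtain u where u: "u \<in> vecs U" "sums_to U E (moduli x) u"
    using assms unfolding in_vecs_iff summable_Cauchy[symmetric] by blast
  then have "(THE u. u \<in> vecs U \<and> sums_to U E (moduli x) u) = u"
    using sums_to_unique by blast
  then show thesis using that[OF u] by (simp add: direct_sum_def moduli_def[abs_def])
qed

lemma pnorm_le_nrm_XE:
  assumes "x \<in> vecs XE" "finite F" "F \<subseteq> E"
  shows "pnorm F (moduli x) \<le> nrm XE x"
  using nrm_XE[OF assms(1)] pnorm_le_nrm assms(2,3) by metis

lemma nrm_XE_leI:
  assumes "x \<in> vecs XE" "\<And>F. finite F \<Longrightarrow> F \<subseteq> E \<Longrightarrow> pnorm F (moduli x) \<le> M"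
  shows "nrm XE x \<le> M"
  using nrm_XE[OF assms(1)] nrm_le_pnorm assms(2) by metis

lemma smult_XE: "smult XE c x = (\<lambda>e. if e \<in> E then smult (X e) c (x e) else 0)"
  by (simp add: direct_sum_def)

lemma norm_moduli_add:
  assumes "e \<in> E" "x e \<in> vecs (X e)" "y e \<in> vecs (X e)"
  shows "norm (moduli (x + y) e) \<le> norm (moduli x e + moduli y e)"
proof -
  interpret Xe: banach "X e" using summands assms by blast
  show ?thesis
    using Xe.nrm_triangle[OF assms(2,3)] Xe.nrm_nonneg[OF assms(2)] Xe.nrm_nonneg[OF assms(3)]
      Xe.nrm_nonneg[OF Xe.add_in[OF assms(2,3)]]
    by (simp add: moduli_def flip: of_real_add)
qed

lemma pnorm_moduli_add:
  assumes "finite F" "F \<subseteq> E" "\<And>e. e \<in> F \<Longrightarrow> x e \<in> vecs (X e)" "\<And>e. e \<in> F \<Longrightarrow> y e \<in> vecs (X e)"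
  shows "pnorm F (moduli (x + y)) \<le> pnorm F (moduli x) + pnorm F (moduli y)"
proof -
  have "pnorm F (moduli (x + y)) \<le> pnorm F (\<lambda>e. moduli x e + moduli y e)"
    using assms by (intro pnorm_mono norm_moduli_add) auto
  also have "\<dots> \<le> pnorm F (moduli x) + pnorm F (moduli y)"
    using assms by (intro pnorm_add)
  finally show ?thesis .
qed

lemma pnorm_moduli_smult:
  assumes "finite F" "F \<subseteq> E" "\<And>e. e \<in> F \<Longrightarrow> x e \<in> vecs (X e)"
  shows "pnorm F (moduli (smult XE c x)) = norm c * pnorm F (moduli x)"
proof -
  have "pnorm F (moduli (smult XE c x)) = pnorm F (\<lambda>e. c * moduli x e)"
  proof (rule pnorm_unimodular[OF assms(1,2)])
    fix e assume e: "e \<in> F"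
    then interpret Xe: banach "X e" using summands assms by blast
    show "norm (moduli (smult XE c x) e) = norm (c * moduli x e)"
      using e assms(2) Xe.nrm_smult[OF assms(3)[OF e]] Xe.nrm_nonneg[OF assms(3)[OF e]]
      by (auto simp: moduli_def smult_XE norm_mult)
  qed
  then show ?thesis using pnorm_scale[OF assms(2)] by simp
qed

sublocale XE: scaled_space XE
proof
  fix c d :: 'k and x y :: "'u \<Rightarrow> 'x"
  note vs = banach.banach[OF summands, THEN banach_space_scaled_space]
  show "smult XE c (x + y) = smult XE c x + smult XE c y"
    by (auto simp: smult_XE scaled_space.smult_add[OF vs])
  show "smult XE c (smult XE d x) = smult XE (c * d) x"
    by (auto simp: smult_XE scaled_space.smult_smult[OF vs])
  show "smult XE 0 x = 0"
    by (auto simp: smult_XE scaled_space.smult_zero_left[OF vs])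
  show "smult XE 1 x = x" if "x \<in> vecs XE"
    using that by (auto simp: smult_XE in_vecs_iff scaled_space.smult_one[OF vs])
  show "0 \<in> vecs XE"
    unfolding in_vecs_iff
  proof (intro conjI allI impI)
    fix \<epsilon> :: real assume "\<epsilon> > 0"
    have "psum G (moduli 0) = 0" if "G \<subseteq> E" for G
      unfolding psum_def by (rule sum.neutral)
        (use that banach.nrm_zero[OF summands] in \<open>auto simp: moduli_def\<close>)
    then show "\<exists>F. finite F \<and> F \<subseteq> E \<and> (\<forall>G. finite G \<longrightarrow> G \<subseteq> E - F \<longrightarrow> pnorm G (moduli 0) < \<epsilon>)"
      using \<open>\<epsilon> > 0\<close> by (intro exI[of _ "{}"]) (simp add: pnorm_def U.nrm_zero)
  qed (auto simp: scaled_space.zero_in[OF vs])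
  show "x + y \<in> vecs XE" if x: "x \<in> vecs XE" and y: "y \<in> vecs XE"
    unfolding in_vecs_iff
  proof (intro conjI allI impI)
    show "\<forall>e\<in>E. (x + y) e \<in> vecs (X e)"
      using x y by (auto simp: in_vecs_iff intro: scaled_space.add_in[OF vs])
    show "(x + y) e = 0" if "e \<notin> E" for e
      using x y that by (auto simp: in_vecs_iff)
    fix \<epsilon> :: real assume "\<epsilon> > 0"
    then obtain F G where F: "finite F" "F \<subseteq> E"
        "\<And>H. finite H \<Longrightarrow> H \<subseteq> E - F \<Longrightarrow> pnorm H (moduli x) < \<epsilon> / 2"
      and G: "finite G" "G \<subseteq> E"
        "\<And>H. finite H \<Longrightarrow> H \<subseteq> E - G \<Longrightarrow> pnorm H (moduli y) < \<epsilon> / 2"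
      using x y half_gt_zero[OF \<open>\<epsilon> > 0\<close>] unfolding in_vecs_iff by metis
    have "pnorm H (moduli (x + y)) < \<epsilon>" if H: "finite H" "H \<subseteq> E - (F \<union> G)" for H
      using pnorm_moduli_add[of H x y] F(3)[of H] G(3)[of H] H coord_in[OF x] coord_in[OF y]
      by fastforce
    then show "\<exists>F. finite F \<and> F \<subseteq> E \<and>
        (\<forall>G. finite G \<longrightarrow> G \<subseteq> E - F \<longrightarrow> pnorm G (moduli (x + y)) < \<epsilon>)"
      using F G by (intro exI[of _ "F \<union> G"]) auto
  qed
  show "smult XE c x \<in> vecs XE" if x: "x \<in> vecs XE"
    unfolding in_vecs_iff
  proof (intro conjI allI impI)
    show "\<forall>e\<in>E. smult XE c x e \<in> vecs (X e)"
      using x by (auto simp: in_vecs_iff smult_XE intro: scaled_space.smult_in[OF vs])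
    show "smult XE c x e = 0" if "e \<notin> E" for e
      using that by (simp add: smult_XE)
    fix \<epsilon> :: real assume "\<epsilon> > 0"
    then have "0 < \<epsilon> / (norm c + 1)" by (simp add: add_nonneg_pos)
    then obtain F where F: "finite F" "F \<subseteq> E"
        "\<And>H. finite H \<Longrightarrow> H \<subseteq> E - F \<Longrightarrow> pnorm H (moduli x) < \<epsilon> / (norm c + 1)"
      using x unfolding in_vecs_iff by metis
    have "pnorm H (moduli (smult XE c x)) < \<epsilon>" if H: "finite H" "H \<subseteq> E - F" for H
    proof -
      have "pnorm H (moduli (smult XE c x)) = norm c * pnorm H (moduli x)"
        using H coord_in[OF x] by (intro pnorm_moduli_smult) auto
      also have "\<dots> \<le> (norm c + 1) * pnorm H (moduli x)"
        using pnorm_nonneg[of H] H by (intro mult_right_mono) auto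
      also have "\<dots> < (norm c + 1) * (\<epsilon> / (norm c + 1))"
        using F(3)[OF H] by (intro mult_strict_left_mono) (auto simp: add_nonneg_pos)
      also have "\<dots> = \<epsilon>" using norm_ge_zero[of c] by (simp add: add_nonneg_eq_0_iff)
      finally show ?thesis .
    qed
    then show "\<exists>F. finite F \<and> F \<subseteq> E \<and>
        (\<forall>G. finite G \<longrightarrow> G \<subseteq> E - F \<longrightarrow> pnorm G (moduli (smult XE c x)) < \<epsilon>)"
      using F by blast
  qed
qed

lemma nrm_XE_triangle:
  assumes "x \<in> vecs XE" "y \<in> vecs XE"
  shows "nrm XE (x + y) \<le> nrm XE x + nrm XE y"
proof (rule nrm_XE_leI[OF XE.add_in[OF assms]])
  fix F assume F: "finite F" "F \<subseteq> E"
  then have "pnorm F (moduli (x + y)) \<le> pnorm F (moduli x) + pnorm F (moduli y)"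
    using coord_in assms by (intro pnorm_moduli_add) auto
  also have "\<dots> \<le> nrm XE x + nrm XE y"
    using F assms by (intro add_mono pnorm_le_nrm_XE)
  finally show "pnorm F (moduli (x + y)) \<le> nrm XE x + nrm XE y" .
qed

lemma nrm_XE_smult_le:
  assumes "x \<in> vecs XE"
  shows "nrm XE (smult XE c x) \<le> norm c * nrm XE x"
proof (rule nrm_XE_leI[OF XE.smult_in[OF assms]])
  fix F assume F: "finite F" "F \<subseteq> E"
  then have "pnorm F (moduli (smult XE c x)) = norm c * pnorm F (moduli x)"
    using coord_in assms by (intro pnorm_moduli_smult) auto
  also have "\<dots> \<le> norm c * nrm XE x"
    using F assms by (intro mult_left_mono pnorm_le_nrm_XE) auto
  finally show "pnorm F (moduli (smult XE c x)) \<le> norm c * nrm XE x" .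
qed

lemma nrm_XE_sum_le:
  fixes n :: nat
  assumes "\<And>i. i < n \<Longrightarrow> v i \<in> vecs XE"
  shows "nrm XE (\<Sum>i<n. smult XE (a i) (v i)) \<le> (\<Sum>i<n. norm (a i) * nrm XE (v i))"
  using assms
proof (induction n)
  case 0
  have "nrm XE 0 \<le> 0"
    using nrm_XE_smult_le[OF XE.zero_in, of 0] by (simp add: XE.smult_zero_left)
  then show ?case by (simp add: zero_fun_def)
next
  case (Suc n)
  have "nrm XE ((\<Sum>i<n. smult XE (a i) (v i)) + smult XE (a n) (v n))
      \<le> nrm XE (\<Sum>i<n. smult XE (a i) (v i)) + nrm XE (smult XE (a n) (v n))"
    using Suc by (intro nrm_XE_triangle XE.sum_in XE.smult_in) auto
  also have "\<dots> \<le> (\<Sum>i<n. norm (a i) * nrm XE (v i)) + norm (a n) * nrm XE (v n)"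
    using Suc by (intro add_mono nrm_XE_smult_le) auto
  finally show ?case by (simp only: sum.lessThan_Suc)
qed

lemma finite_support_in:
  assumes "finite F" "F \<subseteq> E" "\<And>e. e \<in> F \<Longrightarrow> x e \<in> vecs (X e)" "\<And>e. e \<notin> F \<Longrightarrow> x e = 0"
  shows "x \<in> vecs XE"
  unfolding in_vecs_iff
proof (intro conjI allI impI)
  note vs = banach.banach[OF summands, THEN banach_space_scaled_space]
  show "\<forall>e\<in>E. x e \<in> vecs (X e)"
    using assms(3,4) scaled_space.zero_in[OF vs] by metis
  show "x e = 0" if "e \<notin> E" for e using that assms by blast
  fix \<epsilon> :: real assume "\<epsilon> > 0"
  have "psum G (moduli x) = 0" if "G \<subseteq> E - F" for G
    unfolding psum_def by (rule sum.neutral)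
      (use that assms(4) banach.nrm_zero[OF summands] in \<open>auto simp: moduli_def subset_iff\<close>)
  then show "\<exists>F. finite F \<and> F \<subseteq> E \<and> (\<forall>G. finite G \<longrightarrow> G \<subseteq> E - F \<longrightarrow> pnorm G (moduli x) < \<epsilon>)"
    using assms \<open>\<epsilon> > 0\<close> by (intro exI[of _ F]) (simp add: pnorm_def U.nrm_zero)
qed

lemma finite_support_nrm:
  assumes "finite F" "F \<subseteq> E" "x \<in> vecs XE" "\<And>e. e \<notin> F \<Longrightarrow> x e = 0"
  shows "nrm XE x = pnorm F (moduli x)"
proof (rule order.antisym)
  show "nrm XE x \<le> pnorm F (moduli x)"
  proof (rule nrm_XE_leI[OF assms(3)])
    fix G assume G: "finite G" "G \<subseteq> E"
    have "pnorm G (moduli x) \<le> pnorm (F \<union> G) (moduli x)"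
      using G assms by (intro pnorm_mono_set) auto
    also have "\<dots> = pnorm F (moduli x)"
      using G assms banach.nrm_zero[OF summands]
      by (intro pnorm_extend) (auto simp: moduli_def subset_iff)
    finally show "pnorm G (moduli x) \<le> pnorm F (moduli x)" .
  qed
qed (use assms in \<open>intro pnorm_le_nrm_XE\<close>)

text \<open>Uniqueness of the expansion of \<open>0\<close> excludes \<open>0\<close> as a member of the basis.\<close>

lemma basis_nrm_pos:
  assumes "e \<in> E"
  shows "0 < nrm U e"
proof -
  have "e \<noteq> 0"
  proof
    assume "e = 0"
    have "\<exists>!a. (\<forall>e. e \<notin> E \<longrightarrow> a e = 0) \<and> sums_to U E a 0"
      using basis U.zero_in by (simp add: one_unconditional_basis_def)
    moreover have "sums_to U E (\<lambda>e. 0) 0"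
      by (simp add: sums_to_psum psum_def U.nrm_zero)
    moreover have "psum F (\<lambda>e'. if e' = e then 1 else 0) = 0" for F
      unfolding psum_def by (rule sum.neutral) (auto simp: \<open>e = 0\<close>)
    then have "sums_to U E (\<lambda>e'. if e' = e then 1 else 0) 0"
      by (simp add: sums_to_psum U.nrm_zero)
    ultimately have "(\<lambda>e'. if e' = e then 1 else 0) = (\<lambda>e. 0 :: 'k)"
      using assms by (metis (mono_tags, lifting))
    then show False by (metis zero_neq_one)
  qed
  then show ?thesis
    using U.nrm_eq_0[OF basis_in[OF assms]] U.nrm_nonneg[OF basis_in[OF assms]] by simp
qed

lemma coord_nrm_le:
  assumes "x \<in> vecs XE" "e \<in> E"
  shows "nrm (X e) (x e) * nrm U e \<le> nrm XE x"
proof -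
  have "pnorm {e} (moduli x) = nrm (X e) (x e) * nrm U e"
    using U.nrm_smult[OF basis_in[OF assms(2)], of "moduli x e"] norm_moduli[of e x]
      coord_in[OF assms] assms by (simp add: pnorm_def psum_def)
  then show ?thesis using pnorm_le_nrm_XE[OF assms(1), of "{e}"] assms by simp
qed

lemma comb_XE_apply:
  "e \<in> E \<Longrightarrow> comb XE a xs e = (\<Sum>i<length xs. smult (X e) (a i) ((xs ! i) e))"
  by (simp add: comb_def sum_fun_apply smult_XE)

lemma XE_uminus:
  assumes "x \<in> vecs XE"
  shows "smult XE (- 1) x = - x"
proof
  fix e
  show "smult XE (- 1) x e = (- x) e"
  proof (cases "e \<in> E")
    case True
    then interpret Xe: banach "X e" by (rule summands)
    show ?thesis using True by (simp add: smult_XE)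
  next
    case False
    then show ?thesis using assms by (simp add: smult_XE in_vecs_iff)
  qed
qed

lemma XE_minus_in: "x \<in> vecs XE \<Longrightarrow> y \<in> vecs XE \<Longrightarrow> x - y \<in> vecs XE"
  using XE.add_in[of x "- y"] XE.smult_in[of y "- 1"] by (simp add: XE_uminus)

lemma nrm_XE_minus_commute_le:
  assumes "x \<in> vecs XE" "y \<in> vecs XE"
  shows "nrm XE (x - y) \<le> nrm XE (y - x)"
  using nrm_XE_smult_le[of "y - x" "- 1"] XE_minus_in[OF assms(2,1)] by (simp add: XE_uminus)

lemma nrm_comb_perturb_le:
  assumes "length ws = length zs" "set zs \<subseteq> vecs XE" "set ws \<subseteq> vecs XE"
    and "\<And>j. j < length zs \<Longrightarrow> nrm XE (ws ! j - zs ! j) \<le> \<delta> j"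
  shows "nrm XE (comb XE a ws) \<le> nrm XE (comb XE a zs) + (\<Sum>j<length zs. norm (a j) * \<delta> j)"
proof -
  have mem: "ws ! j - zs ! j \<in> vecs XE" if "j < length zs" for j
    using assms that by (intro XE_minus_in) auto
  have "comb XE a ws = comb XE a zs + (\<Sum>j<length zs. smult XE (a j) (ws ! j - zs ! j))"
    unfolding comb_def assms(1) sum.distrib[symmetric] XE.smult_add[symmetric] by simp
  moreover have "nrm XE (comb XE a zs + (\<Sum>j<length zs. smult XE (a j) (ws ! j - zs ! j)))
      \<le> nrm XE (comb XE a zs) + nrm XE (\<Sum>j<length zs. smult XE (a j) (ws ! j - zs ! j))"
    using assms mem by (intro nrm_XE_triangle XE.comb_in XE.sum_in XE.smult_in) auto
  moreover have "nrm XE (\<Sum>j<length zs. smult XE (a j) (ws ! j - zs ! j))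
      \<le> (\<Sum>j<length zs. norm (a j) * nrm XE (ws ! j - zs ! j))"
    using mem by (rule nrm_XE_sum_le)
  moreover have "\<dots> \<le> (\<Sum>j<length zs. norm (a j) * \<delta> j)"
    using assms(4) by (intro sum_mono mult_left_mono) auto
  ultimately show ?thesis by simp
qed


section \<open>Blocks with small coordinates\<close>

text \<open>
  If a coordinate stayed above \<open>\<delta>\<close> on all normalised combinations along \<open>S\<close>, then taking that
  coordinate would carry \<open>S\<close> into the tree of \<open>X\<^sub>e\<close>. As \<open>\<parallel>x\<^sub>e\<parallel> \<parallel>e\<parallel> \<le> \<parallel>x\<parallel>\<close>, the coordinate is
  scaled by \<open>\<parallel>e\<parallel>\<close> to land in the unit ball, and this scaling enters the constant.
\<close>

lemma small_coordinate:
  assumes "1 \<le> p" "e \<in> E" "0 < \<delta>"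
    and empty: "derived_tree_iter \<nu> (T_tree p (X e) (max 1 (inverse (nrm U e * \<delta>)))) = {}"
    and S: "S \<subseteq> T_tree p XE K" "[] \<in> derived_tree_iter \<nu> S"
  shows "\<exists>s\<in>S. \<exists>a. lp_norm p (length s) a = 1 \<and> nrm (X e) (comb XE a s e) \<le> \<delta>"
proof (rule ccontr)
  assume neg: "\<not> ?thesis"
  interpret Xe: banach "X e" using summands assms by blast
  let ?c = "of_real (nrm U e) :: 'k"
  let ?k = "max 1 (inverse (nrm U e * \<delta>))"
  define f where "f x = smult (X e) ?c (x e)" for x :: "'u \<Rightarrow> 'x"
  have pos: "0 < nrm U e" using basis_nrm_pos assms by blast
  have "map f s \<in> T_tree p (X e) ?k" if s: "s \<in> S" for s
  proof (rule Xe.T_treeI[OF assms(1)])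
    have sv: "set s \<subseteq> vecs XE" using s S by (auto simp: in_T_tree_iff)
    then have se: "x e \<in> vecs (X e)" if "x \<in> set s" for x
      using that coord_in assms by blast
    then show "set (map f s) \<subseteq> vecs (X e)" by (auto simp: f_def intro!: Xe.smult_in)
    fix a :: "nat \<Rightarrow> 'k" assume "lp_norm p (length (map f s)) a = 1"
    then have a: "lp_norm p (length s) a = 1" by simp
    have cv: "comb XE a s \<in> vecs XE" using sv by (rule XE.comb_in)
    have "comb (X e) a (map f s) = smult (X e) ?c (comb XE a s e)"
      unfolding comb_XE_apply[OF assms(2)]
      by (simp add: comb_def f_def Xe.smult_sum Xe.smult_smult mult.commute)
    then have eq: "nrm (X e) (comb (X e) a (map f s)) = nrm U e * nrm (X e) (comb XE a s e)"
      using Xe.nrm_smult[OF coord_in[OF cv assms(2)], of ?c] pos by simp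
    also have "\<dots> \<le> nrm XE (comb XE a s)"
      using coord_nrm_le[OF cv assms(2)] by (simp add: mult.commute)
    also have "\<dots> \<le> 1" using s S a by (auto simp: in_T_tree_iff)
    finally have upper: "nrm (X e) (comb (X e) a (map f s)) \<le> 1" .
    have "inverse ?k \<le> inverse (inverse (nrm U e * \<delta>))"
      using pos assms(3)
      by (intro le_imp_inverse_le)
        (simp_all only: max.cobounded2 positive_imp_inverse_positive mult_pos_pos)
    then have "inverse ?k \<le> nrm U e * \<delta>" by (simp only: inverse_inverse_eq)
    moreover have "nrm U e * \<delta> \<le> nrm U e * nrm (X e) (comb XE a s e)"
      using neg s a pos by (intro mult_left_mono) (auto simp: not_le intro: less_imp_le)
    ultimately show "inverse ?k \<le> nrm (X e) (comb (X e) a (map f s)) \<and>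
        nrm (X e) (comb (X e) a (map f s)) \<le> 1" using eq upper by linarith
  qed
  then have "map f [] \<in> derived_tree_iter \<nu> (T_tree p (X e) ?k)"
    using S(2) by (rule derived_tree_iter_map)
  then show False using empty by simp
qed

text \<open>
  Finitely many coordinates are made small one after the other: blocks with small first
  coordinate form a tree, in which a block is sought whose other coordinates are small. Each
  coordinate multiplies the order that is needed, so the ordinals below the bound \<open>W\<close> have to be
  closed under multiplication. It is essential that the order \<open>\<nu>\<close> obtained is less than \<open>W\<close>:
  then \<open>W\<close> serves all finite sets \<open>F\<close> and all \<open>\<epsilon>\<close>.
\<close>

lemma small_coordinates:
  fixes W :: "'o ordinal"
  assumes "1 \<le> p" "finite F" "F \<subseteq> E" "0 < \<epsilon>"
    and W: "osucc 0 < W" "\<And>\<xi> \<eta>. \<xi> < W \<Longrightarrow> \<eta> < W \<Longrightarrow> \<xi> * \<eta> < W"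
    and index: "\<And>e. e \<in> E \<Longrightarrow>
      (\<exists>\<nu><W. \<forall>k\<ge>1. derived_tree_iter \<nu> (T_tree p (X e) k) = {}) \<or>
      p = 1 \<and> (\<forall>k\<ge>1. \<exists>\<nu><W. derived_tree_iter \<nu> (T_tree p (X e) k) = {})"
  shows "\<exists>\<nu><W. \<forall>S. S \<subseteq> T_tree p XE K \<longrightarrow> [] \<in> derived_tree_iter \<nu> S \<longrightarrow>
    (\<exists>s\<in>S. \<exists>a. lp_norm p (length s) a = 1 \<and> (\<forall>e\<in>F. nrm (X e) (comb XE a s e) \<le> \<epsilon>))"
  using assms(2,3)
proof (induction F)
  case empty
  have "\<exists>s\<in>S. \<exists>a :: nat \<Rightarrow> 'k. lp_norm p (length s) a = 1"
    if Nil: "[] \<in> derived_tree_iter (osucc 0 :: 'o ordinal) S" for S :: "('u \<Rightarrow> 'x) list set"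
  proof -
    obtain s where "s \<in> derived_tree_iter (0 :: 'o ordinal) S" "strict_prefix [] s"
      using Nil less_osucc in_derived_tree_iter_iff[of "[]" "osucc 0 :: 'o ordinal" S] by blast
    then have "s \<in> S" "s \<noteq> []" using derived_tree_iter_subset by auto
    then show ?thesis using lp_norm_unit[OF assms(1), of 0 "length s"] by blast
  qed
  then show ?case using W(1) by (intro exI[of _ "osucc 0"]) simp
next
  case (insert e F)
  then have e: "e \<in> E" by simp
  interpret Xe: banach "X e" using summands e by blast
  obtain \<nu>1 where \<nu>1: "\<nu>1 < W" "\<And>S. S \<subseteq> T_tree p XE K \<Longrightarrow> [] \<in> derived_tree_iter \<nu>1 S \<Longrightarrow>
      \<exists>s\<in>S. \<exists>a. lp_norm p (length s) a = 1 \<and> (\<forall>e\<in>F. nrm (X e) (comb XE a s e) \<le> \<epsilon>)"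
    using insert by auto
  obtain \<delta> :: "nat \<Rightarrow> real" where \<delta>: "\<And>j. 0 < \<delta> j" "p = 1 \<Longrightarrow> \<delta> = (\<lambda>j. \<epsilon>)"
    "\<And>n (a :: nat \<Rightarrow> 'k). lp_norm p n a = 1 \<Longrightarrow> (\<Sum>j<n. norm (a j) * \<delta> j) \<le> \<epsilon>"
    using lp_summable_weights[OF assms(1,4)] by metis
  define k where "k j = max 1 (inverse (nrm U e * \<delta> j))" for j
  \<comment> \<open>If only one constant at a time can be handled, then \<open>p = 1\<close> and \<open>k\<close> is constant.\<close>
  have "\<exists>\<nu>0<W. \<forall>j. derived_tree_iter \<nu>0 (T_tree p (X e) (k j)) = {}"
  proof (cases "\<exists>\<nu><W. \<forall>k\<ge>1. derived_tree_iter \<nu> (T_tree p (X e) k) = {}")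
    case True
    then show ?thesis by (metis k_def max.cobounded1)
  next
    case False
    then have "p = 1" and *: "\<And>k. 1 \<le> k \<Longrightarrow> \<exists>\<nu><W. derived_tree_iter \<nu> (T_tree p (X e) k) = {}"
      using index[OF e] by auto
    have "k j = max 1 (inverse (nrm U e * \<epsilon>))" for j using \<delta>(2)[OF \<open>p = 1\<close>] by (simp add: k_def)
    then show ?thesis using *[of "max 1 (inverse (nrm U e * \<epsilon>))"] by auto
  qed
  then obtain \<nu>0 where \<nu>0: "\<nu>0 < W" "\<And>j. derived_tree_iter \<nu>0 (T_tree p (X e) (k j)) = {}"
    by blast
  have "\<exists>s\<in>S. \<exists>a. lp_norm p (length s) a = 1 \<and> (\<forall>e\<in>insert e F. nrm (X e) (comb XE a s e) \<le> \<epsilon>)"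
    if S: "S \<subseteq> T_tree p XE K" "[] \<in> derived_tree_iter (\<nu>0 * \<nu>1) S" for S
  proof -
    define R where "R t b \<longleftrightarrow> t \<in> S \<and> blocking p XE t b \<and>
      (\<forall>j<length b. nrm (X e) ((b ! j) e) \<le> \<delta> j)" for t b
    define B where "B = {b. \<exists>t. R t b}"
    have "[] \<in> derived_tree_iter \<nu>1 B"
    proof (rule derived_tree_iter_blocks[where R = R and T = S and \<mu> = \<nu>0 and t = "[]"])
      show "b \<in> B" if "R t b" for t b using that by (auto simp: B_def)
      show "R [] []"
        using S(2) derived_tree_iter_subset by (auto simp: R_def intro: blocking.Nil)
      show "[] \<in> derived_tree_iter (\<nu>0 * \<nu>1) S" by (rule S)
      fix t b S' assume R: "R t b" and S': "\<And>s. s \<in> S' \<Longrightarrow> t @ s \<in> S"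
        "[] \<in> derived_tree_iter \<nu>0 S'"
      have "S' \<subseteq> T_tree p XE K" using S' S(1) XE.T_tree_append[OF assms(1)] by blast
      then obtain s a where s: "s \<in> S'" "lp_norm p (length s) a = 1"
        "nrm (X e) (comb XE a s e) \<le> \<delta> (length b)"
        using small_coordinate[OF assms(1) e \<delta>(1) \<nu>0(2)[unfolded k_def]] S'(2) by blast
      then have "R (t @ s) (b @ [comb XE a s])"
        using R S'(1) by (auto simp: R_def nth_append less_Suc_eq intro: blocking.snoc)
      then show "\<exists>s\<in>S'. \<exists>z. R (t @ s) (b @ [z])" using s by blast
    qed
    moreover have BT: "B \<subseteq> T_tree p XE K"
      using S(1) XE.blocking_T_tree[OF assms(1)] by (auto simp: B_def R_def)
    ultimately obtain b a where b: "b \<in> B" "lp_norm p (length b) a = 1"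
      "\<forall>e\<in>F. nrm (X e) (comb XE a b e) \<le> \<epsilon>"
      using \<nu>1(2) by blast
    then obtain t where t: "R t b" by (auto simp: B_def)
    obtain c where c: "lp_norm p (length t) c = lp_norm p (length b) a" "comb XE c t = comb XE a b"
      using XE.blocking_comb[OF assms(1), of t b a] t by (auto simp: R_def)
    have bv: "(b ! j) e \<in> vecs (X e)" if "j < length b" for j
      using that b(1) BT coord_in e by (force simp: in_T_tree_iff)
    have "nrm (X e) (comb XE a b e) \<le> (\<Sum>j<length b. norm (a j) * nrm (X e) ((b ! j) e))"
      using Xe.nrm_sum_le[of "{..<length b}" "\<lambda>j. (b ! j) e" a] bv e
      by (simp add: comb_XE_apply)
    also have "\<dots> \<le> (\<Sum>j<length b. norm (a j) * \<delta> j)"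
      using t by (intro sum_mono mult_left_mono) (auto simp: R_def)
    also have "\<dots> \<le> \<epsilon>" by (rule \<delta>(3)[OF b(2)])
    finally show ?thesis using b c t by (intro bexI[of _ t] exI[of _ c]) (auto simp: R_def)
  qed
  then show ?case using W(2)[OF \<nu>0(1) \<nu>1(1)] by (intro exI[of _ "\<nu>0 * \<nu>1"]) blast
qed


section \<open>From disjoint blocks to the space with the basis\<close>

definition supp :: "('u \<Rightarrow> 'x) \<Rightarrow> 'u set" where
  "supp w = {e. w e \<noteq> 0}"

definition flatten :: "('u \<Rightarrow> 'x) \<Rightarrow> 'u" where
  "flatten w = psum (supp w) (moduli w)"

definition finitely_supported :: "('u \<Rightarrow> 'x) set" where
  "finitely_supported = {w \<in> vecs XE. finite (supp w)}"

definition disjointly_supported :: "('u \<Rightarrow> 'x) list \<Rightarrow> bool" where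
  "disjointly_supported ws \<longleftrightarrow>
     (\<forall>i<length ws. \<forall>j<length ws. i \<noteq> j \<longrightarrow> supp (ws ! i) \<inter> supp (ws ! j) = {})"

lemma supp_subset: "w \<in> vecs XE \<Longrightarrow> supp w \<subseteq> E"
  by (auto simp: supp_def in_vecs_iff)

text \<open>
  Taking moduli of coordinates is not additive. For disjoint supports, however, at most one
  vector contributes to each coordinate of a linear combination, and \<open>1\<close>-unconditionality
  absorbs the scalar in front of it.
\<close>

lemma nrm_comb_flatten:
  assumes "set ws \<subseteq> finitely_supported" "disjointly_supported ws"
  shows "nrm U (comb U a (map flatten ws)) = nrm XE (comb XE a ws)"
proof -
  define F where "F = (\<Union>w\<in>set ws. supp w)"
  have wv: "set ws \<subseteq> vecs XE" using assms by (auto simp: finitely_supported_def)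
  have F: "finite F" "F \<subseteq> E"
    using assms wv supp_subset by (auto simp: F_def finitely_supported_def)
  have "smult U (a j) (flatten (ws ! j)) = psum F (\<lambda>e. a j * moduli (ws ! j) e)"
    if "j < length ws" for j
  proof -
    have j: "ws ! j \<in> set ws" using that by simp
    have "flatten (ws ! j) = psum F (moduli (ws ! j))"
      unfolding flatten_def psum_def
    proof (rule sum.mono_neutral_left)
      show "supp (ws ! j) \<subseteq> F" using j by (auto simp: F_def)
      show "\<forall>e\<in>F - supp (ws ! j). smult U (moduli (ws ! j) e) e = 0"
        using F(2) banach.nrm_zero[OF summands] by (auto simp: moduli_def supp_def subset_iff)
    qed (rule F)
    then show ?thesis by (simp add: psum_scale)
  qed
  then have "comb U a (map flatten ws) = psum F (\<lambda>e. \<Sum>j<length ws. a j * moduli (ws ! j) e)"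
    by (simp add: comb_def psum_def U.scale_sum_left sum.swap[of _ "{..<length ws}" F])
  then have "nrm U (comb U a (map flatten ws)) = pnorm F (\<lambda>e. \<Sum>j<length ws. a j * moduli (ws ! j) e)"
    by (simp add: pnorm_def)
  also have "\<dots> = pnorm F (moduli (comb XE a ws))"
  proof (rule pnorm_unimodular[OF F])
    fix e assume e: "e \<in> F"
    then have eE: "e \<in> E" using F by blast
    interpret Xe: banach "X e" using summands eE by blast
    obtain j where j: "j < length ws" "(ws ! j) e \<noteq> 0"
      using e by (auto simp: F_def supp_def in_set_conv_nth)
    have z: "(ws ! i) e = 0" if "i < length ws" "i \<noteq> j" for i
      using assms(2) that j unfolding disjointly_supported_def supp_def by blast
    have single: "(\<Sum>i<length ws. g i) = g j"
      if "\<And>i. i < length ws \<Longrightarrow> i \<noteq> j \<Longrightarrow> g i = 0" for g :: "nat \<Rightarrow> 'b::comm_monoid_add"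
      using that j(1) by (subst sum.remove[of _ j]) auto
    have "(\<Sum>i<length ws. a i * moduli (ws ! i) e) = a j * moduli (ws ! j) e"
      by (rule single) (simp add: moduli_def z Xe.nrm_zero)
    moreover have "(\<Sum>i<length ws. smult (X e) (a i) ((ws ! i) e)) = smult (X e) (a j) ((ws ! j) e)"
      by (rule single) (simp add: z)
    then have "comb XE a ws e = smult (X e) (a j) ((ws ! j) e)"
      using eE by (simp add: comb_XE_apply)
    moreover have "(ws ! j) e \<in> vecs (X e)" using coord_in[of "ws ! j" e] eE j(1) wv nth_mem by blast
    ultimately show "norm (\<Sum>i<length ws. a i * moduli (ws ! i) e) = norm (moduli (comb XE a ws) e)"
      by (simp add: moduli_def norm_mult Xe.nrm_smult Xe.nrm_nonneg)
  qed
  also have "\<dots> = nrm XE (comb XE a ws)"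
  proof (rule finite_support_nrm[symmetric, OF F])
    show cv: "comb XE a ws \<in> vecs XE" using wv by (rule XE.comb_in)
    fix e assume e: "e \<notin> F"
    show "comb XE a ws e = 0"
    proof (cases "e \<in> E")
      case True
      interpret Xe: banach "X e" using summands True by blast
      have "(ws ! i) e = 0" if "i < length ws" for i
        using e that by (auto simp: F_def supp_def)
      then show ?thesis using True by (simp add: comb_XE_apply)
    next
      case False
      then show ?thesis using cv by (simp add: in_vecs_iff)
    qed
  qed
  finally show ?thesis .
qed

text \<open>
  The vector \<open>z\<close> is truncated to a finite set outside \<open>F\<close>. The bounds on the coordinates in \<open>F\<close>
  are such that dropping these costs at most \<open>\<delta>/2\<close> in total; the tail beyond a large finite set
  costs at most \<open>\<delta>/2\<close> as well.
\<close>

lemma nearby_finitely_supported: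
  assumes "z \<in> vecs XE" "finite F" "F \<subseteq> E" "0 < \<delta>"
    and small: "\<And>e. e \<in> F \<Longrightarrow> nrm (X e) (z e) \<le> \<delta> / (2 * (1 + (\<Sum>e\<in>F. nrm U e)))"
  shows "\<exists>w\<in>finitely_supported. supp w \<inter> F = {} \<and> nrm XE (w - z) \<le> \<delta>"
proof -
  let ?\<sigma> = "1 + (\<Sum>e\<in>F. nrm U e)"
  define \<epsilon> where "\<epsilon> = \<delta> / (2 * ?\<sigma>)"
  have \<sigma>: "0 \<le> (\<Sum>e\<in>F. nrm U e)"
    using assms(3) basis_nrm_pos by (intro sum_nonneg) (auto intro: less_imp_le)
  then have \<epsilon>: "0 \<le> \<epsilon>" using assms(4) by (simp add: \<epsilon>_def)
  obtain F' where F': "finite F'" "F' \<subseteq> E"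
    "\<And>G. finite G \<Longrightarrow> G \<subseteq> E - F' \<Longrightarrow> pnorm G (moduli z) < \<delta> / 2"
    using assms(1) half_gt_zero[OF assms(4)] unfolding in_vecs_iff by metis
  define w where "w e = (if e \<in> F' - F then z e else 0)" for e
  have sw: "supp w \<subseteq> F' - F" by (auto simp: supp_def w_def)
  have w: "w \<in> vecs XE"
    by (rule finite_support_in[of "F' - F"]) (use F' coord_in[OF assms(1)] in \<open>auto simp: w_def\<close>)
  have "nrm XE (w - z) \<le> \<delta>"
  proof (rule nrm_XE_leI[OF XE_minus_in[OF w assms(1)]])
    fix G assume G: "finite G" "G \<subseteq> E"
    let ?a = "\<lambda>e. if e \<in> F then of_real \<epsilon> else 0 :: 'k"
    let ?b = "\<lambda>e. if e \<in> F' then 0 else moduli z e"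
    have "pnorm G (moduli (w - z)) \<le> pnorm G (\<lambda>e. ?a e + ?b e)"
    proof (rule pnorm_mono[OF G])
      fix e assume "e \<in> G"
      then have e: "e \<in> E" using G by blast
      interpret Xe: banach "X e" using summands e by blast
      have ze: "z e \<in> vecs (X e)" using coord_in assms(1) e by blast
      have "nrm (X e) (0 - z e) = nrm (X e) (z e)"
        using Xe.nrm_minus_commute[OF Xe.zero_in ze] by simp
      then show "norm (moduli (w - z) e) \<le> norm (?a e + ?b e)"
        using small[of e, folded \<epsilon>_def] \<epsilon> Xe.nrm_nonneg[OF ze]
        by (auto simp: moduli_def w_def Xe.nrm_zero simp flip: of_real_add)
    qed
    also have "\<dots> \<le> pnorm G ?a + pnorm G ?b" by (rule pnorm_add[OF G(2)])
    also have "pnorm G ?b = pnorm (G - F') ?b" by (rule pnorm_extend[OF G]) auto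
    also have "pnorm (G - F') ?b = pnorm (G - F') (moduli z)"
      unfolding pnorm_def by (rule arg_cong[OF psum_cong]) simp
    also have "pnorm (G - F') (moduli z) \<le> \<delta> / 2" using F'(3)[of "G - F'"] G by (simp add: Diff_mono)
    also have "pnorm G ?a \<le> pnorm (G \<union> F) ?a"
      using G assms by (intro pnorm_mono_set) auto
    also have "pnorm (G \<union> F) ?a = pnorm F ?a"
      using G assms by (intro pnorm_extend) auto
    also have "pnorm F ?a \<le> (\<Sum>e\<in>F. norm (?a e) * nrm U e)"
      unfolding pnorm_def psum_def using assms basis_in by (intro U.nrm_sum_le) auto
    also have "\<dots> = \<epsilon> * (\<Sum>e\<in>F. nrm U e)"
      unfolding sum_distrib_left by (rule sum.cong) (use \<epsilon> in auto)
    also have "\<dots> \<le> \<epsilon> * ?\<sigma>" using \<epsilon> by (intro mult_left_mono) auto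
    also have "\<dots> = \<delta> / 2" using \<sigma> by (simp add: \<epsilon>_def field_simps)
    finally show "pnorm G (moduli (w - z)) \<le> \<delta>" by (simp only: field_sum_of_halves)
  qed
  moreover have "w \<in> finitely_supported"
    using w finite_subset[OF sw] F'(1) by (simp add: finitely_supported_def)
  ultimately show ?thesis using sw by blast
qed

text \<open>
  The perturbation may push the upper estimate up to \<open>1 + \<eta>\<close>. Dividing by this number restores it
  and spoils the lower estimate a little further; the gap between \<open>K\<close> and \<open>C\<close> pays for both.
\<close>

lemma flattened_blocks_in_T_tree:
  assumes "1 \<le> p" "0 \<le> \<eta>" and C: "inverse C * (1 + \<eta>) \<le> inverse K - \<eta>"
    and zs: "zs \<in> T_tree p XE K"
    and ws: "length ws = length zs" "set ws \<subseteq> finitely_supported" "disjointly_supported ws"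
    and near: "\<And>j. j < length zs \<Longrightarrow> nrm XE (ws ! j - zs ! j) \<le> \<delta> j"
    and \<delta>: "\<And>a :: nat \<Rightarrow> 'k. lp_norm p (length zs) a = 1 \<Longrightarrow>
      (\<Sum>j<length zs. norm (a j) * \<delta> j) \<le> \<eta>"
  shows "map (\<lambda>w. smult U (of_real (inverse (1 + \<eta>))) (flatten w)) ws \<in> T_tree p U C"
proof (rule U.T_treeI[OF assms(1)])
  let ?r = "of_real (inverse (1 + \<eta>)) :: 'k"
  let ?b = "map (\<lambda>w. smult U ?r (flatten w)) ws"
  have wv: "set ws \<subseteq> vecs XE" using ws by (auto simp: finitely_supported_def)
  have zv: "set zs \<subseteq> vecs XE" using zs by (auto simp: in_T_tree_iff)
  have fv: "flatten w \<in> vecs U" if "w \<in> set ws" for w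
    unfolding flatten_def using that wv supp_subset by (intro psum_in) blast
  then show "set ?b \<subseteq> vecs U" by (auto intro: U.smult_in)
  fix a :: "nat \<Rightarrow> 'k" assume "lp_norm p (length ?b) a = 1"
  then have a: "lp_norm p (length zs) a = 1" using ws by simp
  have near': "nrm XE (zs ! j - ws ! j) \<le> \<delta> j" if "j < length ws" for j
  proof -
    have "nrm XE (zs ! j - ws ! j) \<le> nrm XE (ws ! j - zs ! j)"
      using that ws(1) wv zv by (intro nrm_XE_minus_commute_le) auto
    then show ?thesis using near[of j] that ws(1) by simp
  qed
  have "comb U a ?b = smult U ?r (comb U a (map flatten ws))"
    by (simp add: comb_def U.smult_sum mult.commute)
  moreover have "comb U a (map flatten ws) \<in> vecs U" using fv by (intro U.comb_in) auto
  ultimately have "nrm U (comb U a ?b) = norm ?r * nrm U (comb U a (map flatten ws))"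
    by (simp add: U.nrm_smult)
  also have "\<dots> = nrm XE (comb XE a ws) / (1 + \<eta>)"
    using assms(2)
    by (simp add: nrm_comb_flatten[OF ws(2,3)] divide_inverse norm_inverse del: of_real_add)
  finally have eq: "nrm U (comb U a ?b) = nrm XE (comb XE a ws) / (1 + \<eta>)" .
  have "nrm XE (comb XE a ws) \<le> 1 + \<eta>"
    using nrm_comb_perturb_le[OF ws(1) zv wv near, of a] \<delta>[OF a] zs a
    by (fastforce simp: in_T_tree_iff)
  moreover have "inverse K - \<eta> \<le> nrm XE (comb XE a ws)"
    using nrm_comb_perturb_le[OF ws(1)[symmetric] wv zv near', of a] \<delta>[OF a] zs a ws(1)
    by (fastforce simp: in_T_tree_iff)
  ultimately show "inverse C \<le> nrm U (comb U a ?b) \<and> nrm U (comb U a ?b) \<le> 1"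
    unfolding eq using C assms(2) by (simp add: field_simps)
qed

text \<open>
  A tree of order exceeding \<open>W\<close> above a node contains a block that is small on the finitely many
  coordinates used before; up to a small error it can be replaced by a finitely supported vector
  living on new coordinates only. Along the blocks \<open>zs\<close> one thus carries disjointly supported
  approximations \<open>ws\<close>, and these become the sequences in \<open>U\<close>.
\<close>

lemma Nil_in_derived_tree_direct_sum:
  assumes "1 \<le> p" "1 \<le> K" "K < C"
    and W: "osucc 0 < W" "\<And>\<xi> \<eta>. \<xi> < W \<Longrightarrow> \<eta> < W \<Longrightarrow> \<xi> * \<eta> < W"
    and index: "\<And>e. e \<in> E \<Longrightarrow>
      (\<exists>\<nu><W. \<forall>k\<ge>1. derived_tree_iter \<nu> (T_tree p (X e) k) = {}) \<or>
      p = 1 \<and> (\<forall>k\<ge>1. \<exists>\<nu><W. derived_tree_iter \<nu> (T_tree p (X e) k) = {})"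
    and Nil: "[] \<in> derived_tree_iter (W * \<xi>) (T_tree p XE K)"
  shows "[] \<in> derived_tree_iter \<xi> (T_tree p U C)"
proof -
  \<comment> \<open>The value of \<open>\<eta>\<close> solves \<open>(1/K - \<eta>) / (1 + \<eta>) = 1/C\<close>.\<close>
  define \<eta> where "\<eta> = (inverse K - inverse C) / (1 + inverse C)"
  have "inverse C < inverse K" "0 < inverse C" using assms by (auto intro: less_imp_inverse_less)
  then have "1 + inverse C \<noteq> 0" by linarith
  then have "\<eta> * (1 + inverse C) = inverse K - inverse C" 
    unfolding \<eta>_def by (metis nonzero_divide_eq_eq)
  then have "inverse C * (1 + \<eta>) = inverse K - \<eta>" by (simp add: algebra_simps)
  moreover have "0 < \<eta>"
    unfolding \<eta>_def using \<open>inverse C < inverse K\<close> \<open>0 < inverse C\<close> by (intro divide_pos_pos) linarith+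
  ultimately have \<eta>: "0 < \<eta>" "inverse C * (1 + \<eta>) \<le> inverse K - \<eta>" by simp_all
  obtain \<delta> :: "nat \<Rightarrow> real" where \<delta>: "\<And>j. 0 < \<delta> j"
    "\<And>n (a :: nat \<Rightarrow> 'k). lp_norm p n a = 1 \<Longrightarrow> (\<Sum>j<n. norm (a j) * \<delta> j) \<le> \<eta>"
    using lp_summable_weights[OF assms(1) \<eta>(1)] by metis
  let ?g = "\<lambda>w. smult U (of_real (inverse (1 + \<eta>))) (flatten w)"
  define R where "R t b \<longleftrightarrow> t \<in> T_tree p XE K \<and> (\<exists>zs ws. blocking p XE t zs \<and> b = map ?g ws \<and>
      length ws = length zs \<and> set ws \<subseteq> finitely_supported \<and> disjointly_supported ws \<and>
      (\<forall>j<length zs. nrm XE (ws ! j - zs ! j) \<le> \<delta> j))" for t b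
  show ?thesis
  proof (rule derived_tree_iter_blocks[where R = R and t = "[]" and \<mu> = W])
    show "R [] []"
      unfolding R_def
      by (auto intro!: Nil_in_T_tree exI[of _ "[]"] blocking.Nil simp: disjointly_supported_def)
    show "[] \<in> derived_tree_iter (W * \<xi>) (T_tree p XE K)" by (rule Nil)
    show "b \<in> T_tree p U C" if "R t b" for t b
      using that flattened_blocks_in_T_tree[OF assms(1) less_imp_le[OF \<eta>(1)] \<eta>(2) _ _ _ _ _ \<delta>(2)]
        XE.blocking_T_tree[OF assms(1)] unfolding R_def by blast
    fix t b S assume "R t b" and S: "\<And>s. s \<in> S \<Longrightarrow> t @ s \<in> T_tree p XE K"
      "[] \<in> derived_tree_iter W S"
    then obtain zs ws where b: "blocking p XE t zs" "b = map ?g ws"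
        "length ws = length zs" "set ws \<subseteq> finitely_supported" "disjointly_supported ws"
        "\<And>j. j < length zs \<Longrightarrow> nrm XE (ws ! j - zs ! j) \<le> \<delta> j"
      by (auto simp: R_def)
    let ?n = "length zs"
    define F where "F = (\<Union>w\<in>set ws. supp w)"
    have F: "finite F" "F \<subseteq> E"
      using b(4) supp_subset by (auto simp: F_def finitely_supported_def)
    define \<epsilon> where "\<epsilon> = \<delta> ?n / (2 * (1 + (\<Sum>e\<in>F. nrm U e)))"
    have "0 \<le> (\<Sum>e\<in>F. nrm U e)"
      using F basis_nrm_pos by (intro sum_nonneg) (auto intro: less_imp_le)
    then have "0 < \<epsilon>" using \<delta>(1) by (simp add: \<epsilon>_def)
    from small_coordinates[OF assms(1) F this W index]
    obtain \<nu> where \<nu>: "\<nu> < W" "\<And>S. S \<subseteq> T_tree p XE K \<Longrightarrow> [] \<in> derived_tree_iter \<nu> S \<Longrightarrow>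
        \<exists>s\<in>S. \<exists>a. lp_norm p (length s) a = 1 \<and> (\<forall>e\<in>F. nrm (X e) (comb XE a s e) \<le> \<epsilon>)"
      by metis
    have ST: "S \<subseteq> T_tree p XE K" using S XE.T_tree_append[OF assms(1)] by blast
    obtain s a where s: "s \<in> S" "lp_norm p (length s) a = 1"
        "\<And>e. e \<in> F \<Longrightarrow> nrm (X e) (comb XE a s e) \<le> \<epsilon>"
      using \<nu>(2)[OF ST] S(2) derived_tree_iter_antimono[OF less_imp_le[OF \<nu>(1)]] by blast
    let ?z = "comb XE a s"
    have "?z \<in> vecs XE" using s(1) ST by (intro XE.comb_in) (auto simp: in_T_tree_iff)
    from nearby_finitely_supported[OF this F \<delta>(1) s(3)[unfolded \<epsilon>_def]]
    obtain w where w: "w \<in> finitely_supported" "supp w \<inter> F = {}" "nrm XE (w - ?z) \<le> \<delta> ?n"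
      by blast
    have "supp w \<inter> supp (ws ! j) = {}" if "j < length ws" for j
      using w(2) nth_mem[OF that] unfolding F_def by blast
    then have "disjointly_supported (ws @ [w])"
      using b(5) by (auto simp: disjointly_supported_def nth_append less_Suc_eq)
    moreover have "blocking p XE (t @ s) (zs @ [?z])" using b(1) s(2) by (rule blocking.snoc)
    ultimately have "R (t @ s) (b @ [?g w])"
      unfolding R_def using b w S(1)[OF s(1)]
      by (intro conjI exI[of _ "zs @ [?z]"] exI[of _ "ws @ [w]"])
        (auto simp: nth_append less_Suc_eq)
    then show "\<exists>s\<in>S. \<exists>z. R (t @ s) (b @ [z])" using s(1) by blast
  qed
qed

end

theorem proposition8p5:
  fixes p :: ennreal
    and U :: "('k::{real_normed_field, euclidean_space}, 'u::ab_group_add) nspace"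
    and E :: "'u set"
    and X :: "'u \<Rightarrow> ('k, 'x::ab_group_add) nspace"
    and \<alpha> :: "('u + ('u \<Rightarrow> 'x) + 'a) ordinal"
    and K C :: real
  assumes "1 \<le> p"
    and "banach_space U"
    and "one_unconditional_basis U E"
    and "\<And>e. e \<in> E \<Longrightarrow> banach_space (X e)"
    and "\<And>e. e \<in> E \<Longrightarrow> I_index p (X e) < Ord (omega_pow (omega_pow \<alpha>)) \<or>
           p = 1 \<and> I_index p (X e) \<le> Ord (omega_pow (omega_pow \<alpha>))"
    and "1 \<le> K" and "K < C"
  shows "I_index_at p (direct_sum U E X) K \<le>
           Ord (omega_pow (omega_pow \<alpha>)) * I_index_at p U C"
proof (cases "I_index_at p U C :: ('u + ('u \<Rightarrow> 'x) + 'a) xordinal")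
  case Infty
  then show ?thesis by (simp add: times_xordinal_def)
next
  case (Ord \<xi>)
  interpret unconditional_sum U E X
    using assms by unfold_locales auto
  let ?W = "omega_pow (omega_pow \<alpha>)"
  have lim: "limit_ordinal ?W" by (intro limit_ordinal_omega_pow omega_pow_pos)
  have index: "(\<exists>\<nu><?W. \<forall>k\<ge>1. derived_tree_iter \<nu> (T_tree p (X e) k) = {}) \<or>
      p = 1 \<and> (\<forall>k\<ge>1. \<exists>\<nu><?W. derived_tree_iter \<nu> (T_tree p (X e) k) = {})" if e: "e \<in> E" for e
  proof -
    have at: "tree_order (T_tree p (X e) k) \<le> (I_index p (X e) :: ('u + ('u \<Rightarrow> 'x) + 'a) xordinal)"
      if "1 \<le> k" for k
      unfolding I_index_def I_index_at_def[symmetric] using that by (intro SUP_upper) simp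
    consider \<nu> where "I_index p (X e) = Ord \<nu>" "\<nu> < ?W"
      | "p = 1" "I_index p (X e) \<le> Ord ?W"
      using assms(5)[OF e] by (cases "I_index p (X e) :: ('u + ('u \<Rightarrow> 'x) + 'a) xordinal") auto
    then show ?thesis
    proof cases
      case 1
      then show ?thesis using at tree_order_le_OrdD by metis
    next
      case 2
      then show ?thesis
        using order.trans[OF at 2(2)] tree_order_less_limit[OF Nil_in_T_tree lim] by blast
    qed
  qed
  have "derived_tree_iter \<xi> (T_tree p U C) = {}"
    using Ord by (intro tree_order_le_OrdD) (simp add: I_index_at_def)
  then have "[] \<notin> derived_tree_iter (?W * \<xi>) (T_tree p XE K)"
    using Nil_in_derived_tree_direct_sum[OF assms(1,6,7) osucc_less_limit[OF lim limit_ordinal_pos[OF lim]]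
        mult_less_omega_pow_omega_pow index] by blast
  then have "derived_tree_iter (?W * \<xi>) (T_tree p XE K) = {}"
    using Nil_in_derived_tree_iter[OF Nil_in_T_tree] by blast
  then have "tree_order (T_tree p XE K) \<le> Ord (?W * \<xi>)"
    by (rule tree_order_le_OrdI)
  then show ?thesis using Ord by (simp add: I_index_at_def times_xordinal_def)
qed

end
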